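(* Let $\mathsf{V}$ and $\mathsf{W}$ be pseudovarieties of semigroups such that $\mathsf{V}\subseteq\mathsf{W}$ and $\mathsf{V}$ is multiregularly based in $\mathsf{W}$. If $\mathsf{W}$ is closed under bideterministic product, then so is $\mathsf{V}$.
   Context: All alphabets are finite. A semigroup pseudovariety is a class of finite semigroups closed under subsemigroups, homomorphic images and finite direct products; $\mathsf{S}$ is the pseudovariety of all finite semigroups. $\overline{\Omega}_A\mathsf{V}$ is the free pro-$\mathsf{V}$ semigroup on $A$ (elements of $\overline{\Omega}_A\mathsf{S}$ are pseudowords). For $u\in\overline{\Omega}_A\mathsf{S}$, $[u]_{\mathsf{V}}$ is its image under the continuous homomorphism $\overline{\Omega}_A\mathsf{S}\to\overline{\Omega}_A\mathsf{V}$ sending each letter to itself. A pseudoidentity over $A$ is a formal equality $u=v$ with $u,v\in\overline{\Omega}_A\mathsf{S}$; a finite semigroup $S$ satisfies it if every continuous homomorphism $\overline{\Omega}_A\mathsf{S}\to S$ identifies $u$ and $v$. A set $\Sigma$ of pseudoidentities is a basis of $\mathsf{V}$ if $\mathsf{V}$ is exactly the class of finite semigroups satisfying all members of $\Sigma$. An element $s$ of a semigroup $S$ is regular if $s\in sSs$. A pseudoword $\pi\in\overline{\Omega}_A\mathsf{S}$ is $\mathsf{W}$-multiregular if $[\pi]_{\mathsf{W}}$ is a finite product of regular elements of $\overline{\Omega}_A\mathsf{W}$. For semigroup pseudovarieties $\mathsf{V}\subseteq\mathsf{W}$, $\mathsf{V}$ is multiregularly based in $\mathsf{W}$ if it has a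 basis $\Sigma$ such that, for every $(\pi=\rho)\in\Sigma$, both $\pi$ and $\rho$ are $\mathsf{W}$-multiregular. Closure under bideterministic product. A language $L\subseteq A^*$ is a prefix code (resp. suffix code) if $uA^+\cap L=\emptyset$ (resp. $A^+u\cap L=\emptyset$) for all $u\in L$. A language $L\subseteq A^+$ is $\mathsf{V}$-recognizable if $L=\varphi^{-1}(\varphi(L))$ for some homomorphism $\varphi\colon A^+\to S$ with $S\in\mathsf{V}$. $\mathsf{V}$ is closed under bideterministic product if, for every alphabet $A$ and letter $a\in A$, $LaK$ is $\mathsf{V}$-recognizable whenever each of $L,K$ is either a $\mathsf{V}$-recognizable subset of $A^+$ or equal to $\{1\}$, $La$ is a prefix code and $aK$ is a suffix code. *)

theory Defs
  imports "HOL-Analysis.Analysis" "HOL-Algebra.Congruence"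
begin

section \<open>Semigroups\<close>

record 'a sgrp = "'a partial_object" +
  mul :: "'a \<Rightarrow> 'a \<Rightarrow> 'a" (infixl \<open>\<odot>\<index>\<close> 70)

definition semigrp :: "('a, 'm) sgrp_scheme \<Rightarrow> bool" where
  "semigrp S \<longleftrightarrow> carrier S \<noteq> {} \<and>
     (\<forall>x\<in>carrier S. \<forall>y\<in>carrier S. x \<odot>\<^bsub>S\<^esub> y \<in> carrier S) \<and>
     (\<forall>x\<in>carrier S. \<forall>y\<in>carrier S. \<forall>z\<in>carrier S.
        (x \<odot>\<^bsub>S\<^esub> y) \<odot>\<^bsub>S\<^esub> z = x \<odot>\<^bsub>S\<^esub> (y \<odot>\<^bsub>S\<^esub> z))"

definition sgrp_hom ::
  "('a, 'm) sgrp_scheme \<Rightarrow> ('b, 'n) sgrp_scheme \<Rightarrow> ('a \<Rightarrow> 'b) set" where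
  "sgrp_hom S T = {h \<in> carrier S \<rightarrow> carrier T.
     \<forall>x\<in>carrier S. \<forall>y\<in>carrier S. h (x \<odot>\<^bsub>S\<^esub> y) = h x \<odot>\<^bsub>T\<^esub> h y}"

definition subsemigrp :: "'a set \<Rightarrow> ('a, 'm) sgrp_scheme \<Rightarrow> bool" where
  "subsemigrp B S \<longleftrightarrow> B \<subseteq> carrier S \<and> B \<noteq> {} \<and> (\<forall>x\<in>B. \<forall>y\<in>B. x \<odot>\<^bsub>S\<^esub> y \<in> B)"

text \<open>The set of all products of one or more elements of \<open>X\<close>.\<close>

inductive_set sgrp_gen :: "('a, 'm) sgrp_scheme \<Rightarrow> 'a set \<Rightarrow> 'a set"
  for S (structure) and X where
  incl: "x \<in> X \<Longrightarrow> x \<in> sgrp_gen S X"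
| mult: "x \<in> sgrp_gen S X \<Longrightarrow> y \<in> sgrp_gen S X \<Longrightarrow> x \<odot> y \<in> sgrp_gen S X"

definition prod_sgrp :: "'i set \<Rightarrow> ('i \<Rightarrow> 'a sgrp) \<Rightarrow> ('i \<Rightarrow> 'a) sgrp" where
  "prod_sgrp I S = \<lparr>carrier = (\<Pi>\<^sub>E i\<in>I. carrier (S i)),
                    mul = (\<lambda>x y. \<lambda>i\<in>I. x i \<odot>\<^bsub>S i\<^esub> y i)\<rparr>"

definition regular_elem :: "('a, 'm) sgrp_scheme \<Rightarrow> 'a \<Rightarrow> bool" where
  "regular_elem S s \<longleftrightarrow> s \<in> carrier S \<and> (\<exists>x\<in>carrier S. s = s \<odot>\<^bsub>S\<^esub> x \<odot>\<^bsub>S\<^esub> s)"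


section \<open>Pseudovarieties\<close>

text \<open>
  Every finite semigroup is isomorphic to one whose carrier is a set of natural numbers, so classes
  of finite semigroups closed under isomorphism are represented by their members on subsets of
  \<^typ>\<open>nat\<close>.  Direct products live on a different type; closure under products is therefore stated
  for the isomorphic copies on \<^typ>\<open>nat\<close>.  The empty index set is allowed, so a pseudovariety
  contains the trivial semigroups.
\<close>

definition Fin_sgrp :: "nat sgrp set" where
  "Fin_sgrp = {S. semigrp S \<and> finite (carrier S)}"

definition pseudovariety :: "nat sgrp set \<Rightarrow> bool" where
  "pseudovariety V \<longleftrightarrow> V \<subseteq> Fin_sgrp \<and>
     (\<forall>S\<in>V. \<forall>B. subsemigrp B S \<longrightarrow> S\<lparr>carrier := B\<rparr> \<in> V) \<and>
     (\<forall>S\<in>V. \<forall>T\<in>Fin_sgrp. (\<exists>h\<in>sgrp_hom S T. h ` carrier S = carrier T) \<longrightarrow> T \<in> V) \<and>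
     (\<forall>(I :: nat set) S. \<forall>P\<in>Fin_sgrp. finite I \<longrightarrow> (\<forall>i\<in>I. S i \<in> V) \<longrightarrow>
        (\<exists>h\<in>sgrp_hom P (prod_sgrp I S). bij_betw h (carrier P) (carrier (prod_sgrp I S))) \<longrightarrow>
        P \<in> V)"


section \<open>Free pro-\<open>V\<close> semigroups\<close>

text \<open>
  Alphabets are finite nonempty sets of natural numbers (over the empty alphabet there are no
  pseudowords).  The free pro-\<open>V\<close> semigroup on \<open>A\<close> is the projective limit of the \<open>A\<close>-generated
  members of \<open>V\<close>, as a subspace of the product of finite discrete spaces.  The indices are pairs of
  \<open>S \<in> V\<close> and a map from \<open>A\<close> to \<open>S\<close> whose image generates \<open>S\<close>; the transition maps are the
  homomorphisms that respect the generating maps.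
\<close>

definition alphabet :: "nat set \<Rightarrow> bool" where
  "alphabet A \<longleftrightarrow> finite A \<and> A \<noteq> {}"

type_synonym pro_index = "nat sgrp \<times> (nat \<Rightarrow> nat)"
type_synonym pro_elem = "pro_index \<Rightarrow> nat"

definition gen_idx :: "nat sgrp set \<Rightarrow> nat set \<Rightarrow> pro_index set" where
  "gen_idx V A = {(S, f). S \<in> V \<and> f \<in> A \<rightarrow>\<^sub>E carrier S \<and> sgrp_gen S (f ` A) = carrier S}"

definition free_pro :: "nat sgrp set \<Rightarrow> nat set \<Rightarrow> pro_elem sgrp" where
  "free_pro V A = \<lparr>
     carrier = {x \<in> (\<Pi>\<^sub>E i\<in>gen_idx V A. carrier (fst i)).
       \<forall>(S, f)\<in>gen_idx V A. \<forall>(T, g)\<in>gen_idx V A. \<forall>h\<in>sgrp_hom S T.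
         (\<forall>a\<in>A. h (f a) = g a) \<longrightarrow> h (x (S, f)) = x (T, g)},
     mul = (\<lambda>x y. \<lambda>i\<in>gen_idx V A. x i \<odot>\<^bsub>fst i\<^esub> y i)\<rparr>"

definition free_pro_top :: "nat sgrp set \<Rightarrow> nat set \<Rightarrow> pro_elem topology" where
  "free_pro_top V A = subtopology
     (product_topology (\<lambda>i. discrete_topology (carrier (fst i))) (gen_idx V A))
     (carrier (free_pro V A))"

definition letter :: "nat sgrp set \<Rightarrow> nat set \<Rightarrow> nat \<Rightarrow> pro_elem" where
  "letter V A a = (\<lambda>i\<in>gen_idx V A. snd i a)"

definition free_cls :: "nat sgrp set \<Rightarrow> nat set \<Rightarrow> pro_elem \<Rightarrow> pro_elem" where
  "free_cls V A u = (THE h. h \<in> extensional (carrier (free_pro Fin_sgrp A)) \<and>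
      h \<in> sgrp_hom (free_pro Fin_sgrp A) (free_pro V A) \<and>
      continuous_map (free_pro_top Fin_sgrp A) (free_pro_top V A) h \<and>
      (\<forall>a\<in>A. h (letter Fin_sgrp A a) = letter V A a)) u"

subsection \<open>Basic facts on free pro-\<open>V\<close> semigroups\<close>

lemma sgrp_gen_carrier_update [simp]: "sgrp_gen (S\<lparr>carrier := B\<rparr>) X = sgrp_gen S X"
proof -
  have "x \<in> sgrp_gen S X" if "x \<in> sgrp_gen (S\<lparr>carrier := B\<rparr>) X" for x
    using that by induction (auto intro: sgrp_gen.intros)
  moreover have "x \<in> sgrp_gen (S\<lparr>carrier := B\<rparr>) X" if "x \<in> sgrp_gen S X" for x
    using that
  proof induction
    case (mult x y)
    then show ?case using sgrp_gen.mult[of x "S\<lparr>carrier := B\<rparr>" X y] by simp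
  qed (auto intro: sgrp_gen.intros)
  ultimately show ?thesis by blast
qed

lemma sgrp_gen_subset:
  assumes "semigrp S" "X \<subseteq> carrier S"
  shows "sgrp_gen S X \<subseteq> carrier S"
proof
  fix x assume "x \<in> sgrp_gen S X"
  then show "x \<in> carrier S"
    using assms by induction (auto simp: semigrp_def)
qed

lemma subsemigrp_sgrp_gen:
  assumes "semigrp S" "X \<subseteq> carrier S" "X \<noteq> {}"
  shows "subsemigrp (sgrp_gen S X) S"
  using sgrp_gen_subset[OF assms(1,2)] assms(3)
  by (auto simp: subsemigrp_def intro: sgrp_gen.intros)

lemma sgrp_hom_sgrp_gen:
  assumes "semigrp S" "X \<subseteq> carrier S" "h \<in> sgrp_hom S T" "x \<in> sgrp_gen S X"
  shows "h x \<in> sgrp_gen T (h ` X)"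
  using assms(4)
proof induction
  case (mult x y)
  then have "x \<in> carrier S" "y \<in> carrier S" using sgrp_gen_subset[OF assms(1,2)] by auto
  then show ?case using mult assms(3) by (auto simp: sgrp_hom_def intro: sgrp_gen.intros)
qed (auto intro: sgrp_gen.intros)

lemma sgrp_hom_eq_on_gen:
  assumes "semigrp S" "X \<subseteq> carrier S" "h \<in> sgrp_hom S T" "k \<in> sgrp_hom S T"
    and "\<And>x. x \<in> X \<Longrightarrow> h x = k x" and "x \<in> sgrp_gen S X"
  shows "h x = k x"
  using assms(6)
proof induction
  case (mult x y)
  then have "x \<in> carrier S" "y \<in> carrier S" using sgrp_gen_subset[OF assms(1,2)] by auto
  then show ?case using mult assms(3,4) by (auto simp: sgrp_hom_def)
qed (use assms in auto)

lemma free_pro_compat: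
  assumes "x \<in> carrier (free_pro V A)" "(S, f) \<in> gen_idx V A" "(T, g) \<in> gen_idx V A"
    "h \<in> sgrp_hom S T" "\<forall>a\<in>A. h (f a) = g a"
  shows "h (x (S, f)) = x (T, g)"
proof -
  have "\<forall>(S, f)\<in>gen_idx V A. \<forall>(T, g)\<in>gen_idx V A. \<forall>h\<in>sgrp_hom S T.
         (\<forall>a\<in>A. h (f a) = g a) \<longrightarrow> h (x (S, f)) = x (T, g)"
    using assms(1) by (simp add: free_pro_def)
  from bspec[OF this assms(2)] have "\<forall>(T, g)\<in>gen_idx V A. \<forall>h\<in>sgrp_hom S T.
         (\<forall>a\<in>A. h (f a) = g a) \<longrightarrow> h (x (S, f)) = x (T, g)" by simp
  from bspec[OF this assms(3)] have "\<forall>h\<in>sgrp_hom S T.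
         (\<forall>a\<in>A. h (f a) = g a) \<longrightarrow> h (x (S, f)) = x (T, g)" by simp
  from bspec[OF this assms(4)] show ?thesis using assms(5) by simp
qed

lemma pseudovarietyD:
  assumes "pseudovariety V" "S \<in> V"
  shows "semigrp S" "finite (carrier S)"
proof -
  have "V \<subseteq> Fin_sgrp" using assms(1) unfolding pseudovariety_def by (elim conjE)
  then show "semigrp S" "finite (carrier S)" using assms(2) by (auto simp: Fin_sgrp_def)
qed

lemma
  assumes V: "pseudovariety V" and A: "alphabet A"
  shows semigrp_free_pro: "semigrp (free_pro V A)"
    and letter_in_free_pro: "a \<in> A \<Longrightarrow> letter V A a \<in> carrier (free_pro V A)"
proof -
  have sg: "semigrp S" if "S \<in> V" for S
    using pseudovarietyD[OF V that] by simp
  show l: "letter V A a \<in> carrier (free_pro V A)" if "a \<in> A" for a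
    using that by (auto simp: letter_def free_pro_def gen_idx_def)
  have "x \<odot>\<^bsub>free_pro V A\<^esub> y \<in> carrier (free_pro V A)"
    if x: "x \<in> carrier (free_pro V A)" and y: "y \<in> carrier (free_pro V A)" for x y
  proof -
    have in_S: "x (S, f) \<in> carrier S \<and> y (S, f) \<in> carrier S" if "(S, f) \<in> gen_idx V A" for S f
      using that x y by (fastforce simp: free_pro_def PiE_def Pi_def)
    have cl: "x (S, f) \<odot>\<^bsub>S\<^esub> y (S, f) \<in> carrier S" if "(S, f) \<in> gen_idx V A" for S f
      using sg[of S] in_S[OF that] that by (auto simp: semigrp_def gen_idx_def)
    have "h (x (S, f) \<odot>\<^bsub>S\<^esub> y (S, f)) = x (T, g) \<odot>\<^bsub>T\<^esub> y (T, g)"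
      if "(S, f) \<in> gen_idx V A" "(T, g) \<in> gen_idx V A" "h \<in> sgrp_hom S T" "\<forall>a\<in>A. h (f a) = g a"
      for S f T g h
    proof -
      have "h (x (S, f) \<odot>\<^bsub>S\<^esub> y (S, f)) = h (x (S, f)) \<odot>\<^bsub>T\<^esub> h (y (S, f))"
        using in_S[OF that(1)] that(3) by (auto simp: sgrp_hom_def)
      also have "h (x (S, f)) = x (T, g)" by (rule free_pro_compat[OF x that])
      also have "h (y (S, f)) = y (T, g)" by (rule free_pro_compat[OF y that])
      finally show ?thesis .
    qed
    then show ?thesis using cl by (auto simp: free_pro_def)
  qed
  moreover have "(x \<odot>\<^bsub>free_pro V A\<^esub> y) \<odot>\<^bsub>free_pro V A\<^esub> z = x \<odot>\<^bsub>free_pro V A\<^esub> (y \<odot>\<^bsub>free_pro V A\<^esub> z)"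
    if "x \<in> carrier (free_pro V A)" "y \<in> carrier (free_pro V A)" "z \<in> carrier (free_pro V A)" for x y z
  proof -
    have "(x i \<odot>\<^bsub>fst i\<^esub> y i) \<odot>\<^bsub>fst i\<^esub> z i = x i \<odot>\<^bsub>fst i\<^esub> (y i \<odot>\<^bsub>fst i\<^esub> z i)" if i: "i \<in> gen_idx V A" for i
    proof -
      have "fst i \<in> V" using i by (auto simp: gen_idx_def)
      moreover have "x i \<in> carrier (fst i)" "y i \<in> carrier (fst i)" "z i \<in> carrier (fst i)"
        using that i \<open>x \<in> _\<close> \<open>y \<in> _\<close> \<open>z \<in> _\<close> by (auto simp: free_pro_def PiE_def Pi_def)
      ultimately show ?thesis using sg[of "fst i"] by (auto simp: semigrp_def)
    qed
    then show ?thesis by (auto simp: free_pro_def restrict_def)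
  qed
  ultimately show "semigrp (free_pro V A)"
    using l A by (auto simp: semigrp_def alphabet_def)
qed

lemma pseudovariety_sub:
  assumes "pseudovariety V" "S \<in> V" "subsemigrp B S"
  shows "S\<lparr>carrier := B\<rparr> \<in> V"
  using assms unfolding pseudovariety_def by (elim conjE) simp

lemma pseudovariety_prod:
  fixes I :: "nat set"
  assumes V: "pseudovariety V" and "finite I" "\<forall>i\<in>I. S i \<in> V" "P \<in> Fin_sgrp"
    and "h \<in> sgrp_hom P (prod_sgrp I S)" "bij_betw h (carrier P) (carrier (prod_sgrp I S))"
  shows "P \<in> V"
proof -
  have *: "\<forall>(I :: nat set) S. \<forall>P\<in>Fin_sgrp. finite I \<longrightarrow> (\<forall>i\<in>I. S i \<in> V) \<longrightarrow>
        (\<exists>h\<in>sgrp_hom P (prod_sgrp I S). bij_betw h (carrier P) (carrier (prod_sgrp I S))) \<longrightarrow> P \<in> V"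
    using V unfolding pseudovariety_def by (elim conjE)
  show ?thesis
    by (rule *[THEN spec, THEN spec, THEN bspec, THEN mp, THEN mp, THEN mp, of P I S])
      (use assms in auto)
qed

lemma semigrp_prod_sgrp:
  assumes "\<And>i. i \<in> I \<Longrightarrow> semigrp (S i)"
  shows "semigrp (prod_sgrp I S)"
proof -
  have "carrier (prod_sgrp I S) \<noteq> {}"
    using assms by (auto simp: semigrp_def prod_sgrp_def PiE_eq_empty_iff)
  then show ?thesis
    using assms unfolding semigrp_def prod_sgrp_def by (auto simp: PiE_iff restrict_def extensional_def)
qed

lemma pseudovariety_Fin_sgrp: "pseudovariety Fin_sgrp"
proof -
  have "S\<lparr>carrier := B\<rparr> \<in> Fin_sgrp" if "S \<in> Fin_sgrp" "subsemigrp B S" for S :: "nat sgrp" and B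
  proof -
    have "finite B" using that by (auto simp: subsemigrp_def Fin_sgrp_def intro: finite_subset)
    moreover have "semigrp (S\<lparr>carrier := B\<rparr>)"
      using that by (auto simp: subsemigrp_def Fin_sgrp_def semigrp_def subset_iff)
    ultimately show ?thesis by (simp add: Fin_sgrp_def)
  qed
  then show ?thesis by (auto simp: pseudovariety_def)
qed

text \<open>The letters generate a dense subsemigroup.\<close>

lemma letters_dense:
  assumes V: "pseudovariety V" and A: "alphabet A" and F: "finite F" "F \<subseteq> gen_idx V A"
    and u: "u \<in> carrier (free_pro V A)"
  shows "\<exists>w\<in>sgrp_gen (free_pro V A) (letter V A ` A). \<forall>i\<in>F. w i = u i"
proof -
  obtain e and n :: nat where e: "bij_betw e {..<n} F"
    using F(1) by (metis ex_bij_betw_nat_finite lessThan_atLeast0)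
  define I where "I = {..<n}"
  have eI: "e i \<in> gen_idx V A" "fst (e i) \<in> V" "semigrp (fst (e i))" "finite (carrier (fst (e i)))"
    "snd (e i) \<in> A \<rightarrow>\<^sub>E carrier (fst (e i))" if "i \<in> I" for i
  proof -
    show "e i \<in> gen_idx V A" using that e F(2) by (auto simp: I_def bij_betw_def)
    then show "fst (e i) \<in> V" "snd (e i) \<in> A \<rightarrow>\<^sub>E carrier (fst (e i))" by (auto simp: gen_idx_def)
    then show "semigrp (fst (e i))" "finite (carrier (fst (e i)))"
      using pseudovarietyD[OF V] by auto
  qed
  define S where "S = (\<lambda>i. fst (e i))"
  define PP where "PP = prod_sgrp I S"
  have PPsg: "semigrp PP" unfolding PP_def S_def using eI by (intro semigrp_prod_sgrp) auto
  have PPfin: "finite (carrier PP)"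
    unfolding PP_def prod_sgrp_def S_def using eI by (auto simp: I_def intro!: finite_PiE)
  obtain c :: "(nat \<Rightarrow> nat) \<Rightarrow> nat" where c: "inj_on c (carrier PP)"
    using PPfin finite_imp_inj_to_nat_seg by metis
  define d where "d = inv_into (carrier PP) c"
  have dc [simp]: "d (c x) = x" if "x \<in> carrier PP" for x
    using that c by (simp add: d_def)
  define P :: "nat sgrp" where "P = \<lparr>carrier = c ` carrier PP, mul = (\<lambda>x y. c (d x \<odot>\<^bsub>PP\<^esub> d y))\<rparr>"
  have Psg: "semigrp P" using PPsg by (auto simp: P_def semigrp_def)
  then have PFin: "P \<in> Fin_sgrp" using PPfin by (auto simp: Fin_sgrp_def P_def)
  have dhom: "d \<in> sgrp_hom P PP" using PPsg by (auto simp: P_def sgrp_hom_def semigrp_def)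
  have dbij: "bij_betw d (carrier P) (carrier PP)"
    using c by (auto simp: P_def d_def intro: inj_on_imp_bij_betw bij_betw_inv_into)
  have PV: "P \<in> V"
  proof -
    have "\<forall>i\<in>I. S i \<in> V" using eI by (auto simp: S_def)
    then show ?thesis
      using pseudovariety_prod[OF V _ _ PFin dhom[unfolded PP_def] dbij[unfolded PP_def]]
      by (simp add: I_def)
  qed
  define g where "g = (\<lambda>a. \<lambda>i\<in>I. snd (e i) a)"
  have g: "g a \<in> carrier PP" if "a \<in> A" for a
    using that eI by (auto simp: g_def PP_def prod_sgrp_def S_def PiE_def Pi_def)
  define f where "f = (\<lambda>a\<in>A. c (g a))"
  have fA: "f ` A \<subseteq> carrier P" "f ` A \<noteq> {}" using g A by (auto simp: f_def P_def alphabet_def)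
  define B where "B = sgrp_gen P (f ` A)"
  define Q where "Q = P\<lparr>carrier := B\<rparr>"
  have sub: "subsemigrp B P" unfolding B_def by (rule subsemigrp_sgrp_gen[OF Psg fA])
  then have QV: "Q \<in> V" using pseudovariety_sub[OF V PV] by (simp add: Q_def)
  have BP: "B \<subseteq> carrier P" using sub by (simp add: subsemigrp_def)
  have k: "(Q, f) \<in> gen_idx V A"
    using QV by (auto simp: gen_idx_def Q_def f_def B_def intro: sgrp_gen.incl)
  have proj: "x (e i) = d (x (Q, f)) i" if x: "x \<in> carrier (free_pro V A)" and i: "i \<in> I" for x i
  proof -
    have "(\<lambda>q. d q i) \<in> sgrp_hom Q (S i)"
    proof -
      have "d q \<in> carrier PP" if "q \<in> B" for q using that BP dhom by (auto simp: sgrp_hom_def)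
      then have "d q i \<in> carrier (S i)" if "q \<in> B" for q
        using i that by (fastforce simp: PP_def prod_sgrp_def PiE_def Pi_def)
      moreover have "d (q \<odot>\<^bsub>P\<^esub> r) i = d q i \<odot>\<^bsub>S i\<^esub> d r i" if "q \<in> B" "r \<in> B" for q r
      proof -
        have "d (q \<odot>\<^bsub>P\<^esub> r) = d q \<odot>\<^bsub>PP\<^esub> d r" using dhom that BP by (auto simp: sgrp_hom_def)
        then show ?thesis using i by (simp add: PP_def prod_sgrp_def)
      qed
      ultimately show ?thesis by (auto simp: sgrp_hom_def Q_def)
    qed
    moreover have "\<forall>a\<in>A. d (f a) i = snd (e i) a" using g i by (simp add: f_def) (simp add: g_def)
    moreover have "(S i, snd (e i)) \<in> gen_idx V A" using eI(1)[OF i] by (simp add: S_def)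
    ultimately have "d (x (Q, f)) i = x (S i, snd (e i))"
      using free_pro_compat[OF x k, of "S i" "snd (e i)" "\<lambda>q. d q i"] by blast
    then show ?thesis by (simp add: S_def)
  qed
  have "\<exists>w\<in>sgrp_gen (free_pro V A) (letter V A ` A). w (Q, f) = q" if "q \<in> B" for q
    using that unfolding B_def
  proof induction
    case (incl q)
    then obtain a where a: "a \<in> A" "q = f a" by auto
    then have "letter V A a (Q, f) = q" using k by (simp add: letter_def)
    then show ?case using a by (auto intro: sgrp_gen.incl)
  next
    case (mult q r)
    then obtain w v where w: "w \<in> sgrp_gen (free_pro V A) (letter V A ` A)" "w (Q, f) = q"
      and v: "v \<in> sgrp_gen (free_pro V A) (letter V A ` A)" "v (Q, f) = r" by blast
    have "(w \<odot>\<^bsub>free_pro V A\<^esub> v) (Q, f) = q \<odot>\<^bsub>P\<^esub> r" using k w v by (simp add: free_pro_def Q_def)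
    then show ?case using w v by (auto intro: sgrp_gen.mult)
  qed
  moreover have "u (Q, f) \<in> B"
    using u k by (fastforce simp: free_pro_def Q_def PiE_def Pi_def)
  ultimately obtain w where w: "w \<in> sgrp_gen (free_pro V A) (letter V A ` A)" "w (Q, f) = u (Q, f)"
    by blast
  have "letter V A ` A \<subseteq> carrier (free_pro V A)"
    using letter_in_free_pro[OF V A] by auto
  then have wc: "w \<in> carrier (free_pro V A)"
    using w(1) sgrp_gen_subset[OF semigrp_free_pro[OF V A]] by blast
  have "w j = u j" if j: "j \<in> F" for j
  proof -
    obtain i where "i \<in> I" "j = e i" using j e unfolding I_def bij_betw_def by blast
    then show ?thesis using proj[OF wc] proj[OF u] w(2) by simp
  qed
  then show ?thesis using w(1) by blast
qed

lemma topspace_free_pro_top [simp]: "topspace (free_pro_top V A) = carrier (free_pro V A)"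
  by (auto simp: free_pro_top_def free_pro_def)

lemma free_pro_top_proj:
  assumes "i \<in> gen_idx V A"
  shows "continuous_map (free_pro_top V A) (discrete_topology (carrier (fst i))) (\<lambda>x. x i)"
  unfolding free_pro_top_def using assms
  by (intro continuous_map_from_subtopology continuous_map_product_projection[of _ _ "\<lambda>i. discrete_topology (carrier (fst i))"])

lemma free_pro_proj_hom:
  assumes "i \<in> gen_idx V A"
  shows "(\<lambda>x. x i) \<in> sgrp_hom (free_pro V A) (fst i)"
  using assms by (auto simp: sgrp_hom_def free_pro_def)

lemma Hausdorff_free_pro: "Hausdorff_space (free_pro_top V A)"
  by (simp add: free_pro_top_def Hausdorff_space_subtopology Hausdorff_space_product_topology)

lemma compact_free_pro:
  assumes V: "pseudovariety V"
  shows "compact_space (free_pro_top V A)"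
proof -
  define X where "X = product_topology (\<lambda>i. discrete_topology (carrier (fst i))) (gen_idx V A)"
  define J where "J = {((S, f), (T, g), h) | S f T g h. (S, f) \<in> gen_idx V A \<and> (T, g) \<in> gen_idx V A \<and>
    h \<in> sgrp_hom S T \<and> (\<forall>a\<in>A. h (f a) = g a)}"
  define C where "C = (\<lambda>(i, j, h). {x \<in> topspace X. h (x i) = x j} :: pro_elem set)"
  have "compact_space X"
    unfolding X_def compact_space_product_topology using pseudovarietyD[OF V]
    by (auto simp: gen_idx_def compact_space_discrete_topology)
  moreover have "closedin X (carrier (free_pro V A))"
  proof -
    have "closedin X (C t)" if t: "t \<in> J" for t
    proof -
      obtain S f T g h where *: "t = ((S, f), (T, g), h)" "(S, f) \<in> gen_idx V A" "(T, g) \<in> gen_idx V A"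
        "h \<in> sgrp_hom S T" using t by (auto simp: J_def)
      have p: "continuous_map X (discrete_topology (carrier S)) (\<lambda>x. x (S, f))"
        "continuous_map X (discrete_topology (carrier T)) (\<lambda>x. x (T, g))"
        using continuous_map_product_projection[OF *(2), of "\<lambda>i. discrete_topology (carrier (fst i))"]
          continuous_map_product_projection[OF *(3), of "\<lambda>i. discrete_topology (carrier (fst i))"]
        by (simp_all add: X_def)
      have "continuous_map (discrete_topology (carrier S)) (discrete_topology (carrier T)) h"
        using *(4) by (simp add: sgrp_hom_def)
      then have "continuous_map X (discrete_topology (carrier T)) (\<lambda>x. h (x (S, f)))"
        by (rule continuous_map_compose[OF p(1), unfolded o_def])
      then show ?thesis
        using closedin_continuous_maps_eq[OF _ _ p(2)] by (simp add: C_def *(1))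
    qed
    then have "closedin X (\<Inter> (insert (topspace X) (C ` J)))" by (intro closedin_Inter) auto
    moreover have "\<Inter> (insert (topspace X) (C ` J)) = carrier (free_pro V A)" (is "?L = ?R")
    proof
      show "?R \<subseteq> ?L"
      proof
        fix x assume x: "x \<in> ?R"
        then have "x \<in> topspace X" by (simp add: X_def free_pro_def)
        then show "x \<in> ?L" using free_pro_compat[OF x] by (auto simp: C_def J_def)
      qed
      show "?L \<subseteq> ?R"
      proof
        fix x assume x: "x \<in> ?L"
        have "h (x (S, f)) = x (T, g)" if "(S, f) \<in> gen_idx V A" "(T, g) \<in> gen_idx V A"
          "h \<in> sgrp_hom S T" "\<forall>a\<in>A. h (f a) = g a" for S f T g h
        proof -
          have "((S, f), (T, g), h) \<in> J" using that by (simp add: J_def)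
          then have "x \<in> C ((S, f), (T, g), h)" using x by blast
          then show ?thesis by (simp add: C_def)
        qed
        moreover have "x \<in> (\<Pi>\<^sub>E i\<in>gen_idx V A. carrier (fst i))" using x by (simp add: X_def)
        ultimately show "x \<in> ?R" by (simp add: free_pro_def) blast
      qed
    qed
    ultimately show ?thesis by simp
  qed
  ultimately show ?thesis
    by (simp add: free_pro_top_def X_def closedin_compact_space compact_space_subtopology)
qed

lemma continuous_mul_free_pro:
  assumes V: "pseudovariety V" and A: "alphabet A"
  shows "continuous_map (prod_topology (free_pro_top V A) (free_pro_top V A)) (free_pro_top V A)
    (\<lambda>(x, y). x \<odot>\<^bsub>free_pro V A\<^esub> y)"
proof -
  let ?F = "free_pro_top V A" and ?m = "\<lambda>p. fst p \<odot>\<^bsub>free_pro V A\<^esub> snd p"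
  have "continuous_map (prod_topology ?F ?F) (discrete_topology (carrier (fst i))) (\<lambda>p. ?m p i)"
    if i: "i \<in> gen_idx V A" for i
  proof -
    let ?D = "discrete_topology (carrier (fst i))"
    have c: "continuous_map (prod_topology ?F ?F) (prod_topology ?D ?D) (\<lambda>p. (fst p i, snd p i))"
      using continuous_map_compose[OF continuous_map_fst free_pro_top_proj[OF i]]
        continuous_map_compose[OF continuous_map_snd free_pro_top_proj[OF i]]
      by (auto simp: continuous_map_pairwise o_def)
    have "semigrp (fst i)" using pseudovarietyD[OF V] i by (auto simp: gen_idx_def)
    then have "continuous_map (prod_topology ?D ?D) ?D (\<lambda>p. fst p \<odot>\<^bsub>fst i\<^esub> snd p)"
      by (auto simp: prod_topology_discrete_topology[symmetric] semigrp_def)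
    from continuous_map_compose[OF c this] show ?thesis using i by (simp add: o_def free_pro_def)
  qed
  then have "continuous_map (prod_topology ?F ?F)
      (product_topology (\<lambda>i. discrete_topology (carrier (fst i))) (gen_idx V A)) ?m"
    by (subst continuous_map_componentwise) (auto simp: free_pro_def)
  moreover have "?m \<in> topspace (prod_topology ?F ?F) \<rightarrow> carrier (free_pro V A)"
    using semigrp_free_pro[OF V A] by (auto simp: semigrp_def)
  ultimately have "continuous_map (prod_topology ?F ?F) ?F ?m"
    by (subst (3) free_pro_top_def) (auto simp: continuous_map_in_subtopology)
  then show ?thesis by (simp add: case_prod_unfold)
qed

text \<open>Continuous homomorphisms into finite semigroups are determined by the images of letters.\<close>

lemma free_pro_hom_unique:
  assumes V: "pseudovariety V" and A: "alphabet A"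
    and h: "h \<in> sgrp_hom (free_pro V A) T" "continuous_map (free_pro_top V A) (discrete_topology (carrier T)) h"
    and k: "k \<in> sgrp_hom (free_pro V A) T" "continuous_map (free_pro_top V A) (discrete_topology (carrier T)) k"
    and eq: "\<And>a. a \<in> A \<Longrightarrow> h (letter V A a) = k (letter V A a)"
    and u: "u \<in> carrier (free_pro V A)"
  shows "h u = k u"
proof -
  let ?X = "\<lambda>i. discrete_topology (carrier (fst i))"
  let ?U = "{x \<in> carrier (free_pro V A). h x \<in> {h u}} \<inter> {x \<in> carrier (free_pro V A). k x \<in> {k u}}"
  have "h u \<in> carrier T" "k u \<in> carrier T" using h(1) k(1) u by (auto simp: sgrp_hom_def)
  then have "openin (free_pro_top V A) ?U"
    using openin_continuous_map_preimage[OF h(2), of "{h u}"] openin_continuous_map_preimage[OF k(2), of "{k u}"]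
    by (intro openin_Int) auto
  then obtain G where G: "openin (product_topology ?X (gen_idx V A)) G" "?U = G \<inter> carrier (free_pro V A)"
    by (auto simp: free_pro_top_def openin_subtopology)
  have "u \<in> G" using u G(2) by blast
  then obtain U where U: "finite {i \<in> gen_idx V A. U i \<noteq> topspace (?X i)}" "u \<in> Pi\<^sub>E (gen_idx V A) U"
    "Pi\<^sub>E (gen_idx V A) U \<subseteq> G"
    using G(1) unfolding openin_product_topology_alt by meson
  define F where "F = {i \<in> gen_idx V A. U i \<noteq> topspace (?X i)}"
  obtain w where w: "w \<in> sgrp_gen (free_pro V A) (letter V A ` A)" "\<forall>i\<in>F. w i = u i"
    using letters_dense[OF V A _ _ u, of F] U(1) by (auto simp: F_def)
  have lc: "letter V A ` A \<subseteq> carrier (free_pro V A)"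
    using letter_in_free_pro[OF V A] by auto
  have wc: "w \<in> carrier (free_pro V A)"
    using w(1) sgrp_gen_subset[OF semigrp_free_pro[OF V A] lc] by blast
  have wP: "w \<in> (\<Pi>\<^sub>E i\<in>gen_idx V A. carrier (fst i))" using wc by (simp add: free_pro_def)
  have "w i \<in> U i" if i: "i \<in> gen_idx V A" for i
  proof (cases "i \<in> F")
    case True
    then show ?thesis using w(2) U(2) i by auto
  next
    case False
    then have "U i = carrier (fst i)" using i by (simp add: F_def)
    then show ?thesis using wP i by auto
  qed
  then have "w \<in> Pi\<^sub>E (gen_idx V A) U" using wP by (auto simp: PiE_iff)
  then have "w \<in> ?U" using U(3) G(2) wc by blast
  then have "h w = h u" "k w = k u" by auto
  moreover have "h w = k w"
    using sgrp_hom_eq_on_gen[OF semigrp_free_pro[OF V A] lc h(1) k(1) _ w(1)] eq by blast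
  ultimately show ?thesis by simp
qed

text \<open>The universal property: every map from \<open>A\<close> to a member of \<open>V\<close> extends uniquely to a
  continuous homomorphism.\<close>

lemma free_pro_universal:
  assumes V: "pseudovariety V" and A: "alphabet A" and T: "T \<in> V" and f: "f \<in> A \<rightarrow> carrier T"
  shows "\<exists>!h. h \<in> extensional (carrier (free_pro V A)) \<and> h \<in> sgrp_hom (free_pro V A) T \<and>
    continuous_map (free_pro_top V A) (discrete_topology (carrier T)) h \<and> (\<forall>a\<in>A. h (letter V A a) = f a)"
proof (rule ex_ex1I)
  define B where "B = sgrp_gen T (f ` A)"
  have Tsg: "semigrp T" using pseudovarietyD[OF V T] by simp
  have sub: "subsemigrp B T"
    unfolding B_def using f A by (intro subsemigrp_sgrp_gen[OF Tsg]) (auto simp: alphabet_def)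
  then have BT: "B \<subseteq> carrier T" by (simp add: subsemigrp_def)
  define i where "i = (T\<lparr>carrier := B\<rparr>, restrict f A)"
  have i: "i \<in> gen_idx V A"
    using pseudovariety_sub[OF V T sub] by (auto simp: i_def gen_idx_def B_def intro: sgrp_gen.incl)
  let ?h = "restrict (\<lambda>x. x i) (carrier (free_pro V A))"
  have cl: "x \<odot>\<^bsub>free_pro V A\<^esub> y \<in> carrier (free_pro V A)"
    if "x \<in> carrier (free_pro V A)" "y \<in> carrier (free_pro V A)" for x y
    using semigrp_free_pro[OF V A] that by (auto simp: semigrp_def)
  have "?h \<in> sgrp_hom (free_pro V A) T"
    using free_pro_proj_hom[OF i] BT cl by (auto simp: sgrp_hom_def i_def)
  moreover have "continuous_map (free_pro_top V A) (discrete_topology (carrier T)) (\<lambda>x. x i)"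
  proof (rule continuous_map_into_fulltopology)
    show "continuous_map (free_pro_top V A) (subtopology (discrete_topology (carrier T)) B) (\<lambda>x. x i)"
      using free_pro_top_proj[OF i] BT by (simp add: i_def Int_absorb1)
  qed
  then have "continuous_map (free_pro_top V A) (discrete_topology (carrier T)) ?h"
    by (rule continuous_map_eq) simp
  moreover have "\<forall>a\<in>A. ?h (letter V A a) = f a"
    using letter_in_free_pro[OF V A] i by (auto simp: letter_def) (auto simp: i_def)
  ultimately show "\<exists>h. h \<in> extensional (carrier (free_pro V A)) \<and> h \<in> sgrp_hom (free_pro V A) T \<and>
    continuous_map (free_pro_top V A) (discrete_topology (carrier T)) h \<and> (\<forall>a\<in>A. h (letter V A a) = f a)"
    by (intro exI[of _ ?h]) auto
next
  fix h k
  assume "h \<in> extensional (carrier (free_pro V A)) \<and> h \<in> sgrp_hom (free_pro V A) T \<and>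
    continuous_map (free_pro_top V A) (discrete_topology (carrier T)) h \<and> (\<forall>a\<in>A. h (letter V A a) = f a)"
    "k \<in> extensional (carrier (free_pro V A)) \<and> k \<in> sgrp_hom (free_pro V A) T \<and>
    continuous_map (free_pro_top V A) (discrete_topology (carrier T)) k \<and> (\<forall>a\<in>A. k (letter V A a) = f a)"
  then show "h = k"
    using free_pro_hom_unique[OF V A, of h T k] by (intro extensionalityI[of h _ k]) auto
qed

text \<open>Consequently \<^const>\<open>free_cls\<close> is well defined, and it is the restriction of families.\<close>

lemma
  assumes V: "pseudovariety V" and A: "alphabet A"
  shows free_cls_ex1: "\<exists>!h. h \<in> extensional (carrier (free_pro Fin_sgrp A)) \<and>
      h \<in> sgrp_hom (free_pro Fin_sgrp A) (free_pro V A) \<and>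
      continuous_map (free_pro_top Fin_sgrp A) (free_pro_top V A) h \<and>
      (\<forall>a\<in>A. h (letter Fin_sgrp A a) = letter V A a)" (is "\<exists>!h. ?P h")
    and free_cls_eq: "u \<in> carrier (free_pro Fin_sgrp A) \<Longrightarrow> free_cls V A u = restrict u (gen_idx V A)"
proof -
  have VF: "V \<subseteq> Fin_sgrp" using pseudovarietyD[OF V] by (auto simp: Fin_sgrp_def)
  have sub: "gen_idx V A \<subseteq> gen_idx Fin_sgrp A" using VF by (auto simp: gen_idx_def)
  let ?C = "carrier (free_pro Fin_sgrp A)"
  let ?r = "\<lambda>u. restrict u (gen_idx V A)"
  let ?h = "restrict ?r ?C"
  have cl: "x \<odot>\<^bsub>free_pro Fin_sgrp A\<^esub> y \<in> ?C" if "x \<in> ?C" "y \<in> ?C" for x y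
    using semigrp_free_pro[OF pseudovariety_Fin_sgrp A] that by (auto simp: semigrp_def)
  have rC: "?r x \<in> carrier (free_pro V A)" if x: "x \<in> ?C" for x
  proof -
    have "x \<in> (\<Pi>\<^sub>E i\<in>gen_idx Fin_sgrp A. carrier (fst i))" using x by (simp add: free_pro_def)
    then have "?r x \<in> (\<Pi>\<^sub>E i\<in>gen_idx V A. carrier (fst i))" using sub by (auto simp: PiE_def Pi_def)
    moreover have "h (x (S, f)) = x (T, g)"
      if "(S, f) \<in> gen_idx V A" "(T, g) \<in> gen_idx V A" "h \<in> sgrp_hom S T" "\<forall>a\<in>A. h (f a) = g a" for S f T g h
      by (rule free_pro_compat[OF x subsetD[OF sub that(1)] subsetD[OF sub that(2)] that(3,4)])
    ultimately show ?thesis by (auto simp: free_pro_def)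
  qed
  have "?h \<in> sgrp_hom (free_pro Fin_sgrp A) (free_pro V A)"
    using rC cl sub by (auto simp: sgrp_hom_def) (auto simp: free_pro_def fun_eq_iff)
  moreover have "continuous_map (free_pro_top Fin_sgrp A) (free_pro_top V A) ?h"
  proof -
    have "continuous_map (free_pro_top Fin_sgrp A) (discrete_topology (carrier (fst i))) (\<lambda>u. ?r u i)"
      if "i \<in> gen_idx V A" for i
      using free_pro_top_proj[of i Fin_sgrp A] sub that by auto
    then have "continuous_map (free_pro_top Fin_sgrp A)
        (product_topology (\<lambda>i. discrete_topology (carrier (fst i))) (gen_idx V A)) ?r"
      by (subst continuous_map_componentwise) auto
    then have "continuous_map (free_pro_top Fin_sgrp A) (free_pro_top V A) ?r"
      using rC by (subst free_pro_top_def[of V]) (auto simp: continuous_map_in_subtopology)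
    then show ?thesis by (rule continuous_map_eq) simp
  qed
  moreover have "\<forall>a\<in>A. ?h (letter Fin_sgrp A a) = letter V A a"
    using letter_in_free_pro[OF pseudovariety_Fin_sgrp A] sub
    by (auto simp: letter_def fun_eq_iff restrict_def)
  ultimately have Ph: "?P ?h" by simp
  have uniq: "k = ?h" if k: "?P k" for k
  proof (rule extensionalityI[of _ ?C])
    fix u assume u: "u \<in> ?C"
    have "k u i = ?h u i" if i: "i \<in> gen_idx V A" for i
    proof -
      have comp: "(\<lambda>x. q x i) \<in> sgrp_hom (free_pro Fin_sgrp A) (fst i) \<and>
          continuous_map (free_pro_top Fin_sgrp A) (discrete_topology (carrier (fst i))) (\<lambda>x. q x i)"
        if q: "?P q" for q
      proof
        show "(\<lambda>x. q x i) \<in> sgrp_hom (free_pro Fin_sgrp A) (fst i)"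
          using q free_pro_proj_hom[OF i] by (auto simp: sgrp_hom_def Pi_def)
        show "continuous_map (free_pro_top Fin_sgrp A) (discrete_topology (carrier (fst i))) (\<lambda>x. q x i)"
          using continuous_map_compose[of "free_pro_top Fin_sgrp A" "free_pro_top V A" q, OF _ free_pro_top_proj[OF i]] q
          by (simp add: o_def)
      qed
      show ?thesis
        using free_pro_hom_unique[OF pseudovariety_Fin_sgrp A, of "\<lambda>x. k x i" "fst i" "\<lambda>x. ?h x i"]
          comp[OF k] comp[OF Ph] k Ph u by simp
    qed
    moreover have "k u \<in> extensional (gen_idx V A)" "?h u \<in> extensional (gen_idx V A)"
      using k Ph u by (auto simp: sgrp_hom_def free_pro_def PiE_def Pi_def)
    ultimately show "k u = ?h u" by (intro extensionalityI)
  qed (use k in auto)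
  show "\<exists>!h. ?P h" using Ph uniq by blast
  have "(THE h. ?P h) = ?h" by (rule the_equality) (use Ph uniq in blast)+
  then show "free_cls V A u = restrict u (gen_idx V A)" if "u \<in> ?C"
    using that by (simp add: free_cls_def)
qed


section \<open>Pseudoidentities\<close>

text \<open>The triple \<open>(A, u, v)\<close> stands for the pseudoidentity \<open>u = v\<close> over the alphabet \<open>A\<close>.\<close>

type_synonym pseudoid = "nat set \<times> pro_elem \<times> pro_elem"

definition pseudoids :: "pseudoid set" where
  "pseudoids = {(A, u, v). alphabet A \<and>
     u \<in> carrier (free_pro Fin_sgrp A) \<and> v \<in> carrier (free_pro Fin_sgrp A)}"

definition satisfies :: "nat sgrp \<Rightarrow> pseudoid \<Rightarrow> bool" where
  "satisfies S e \<longleftrightarrow> (case e of (A, u, v) \<Rightarrow>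
     \<forall>h\<in>sgrp_hom (free_pro Fin_sgrp A) S.
       continuous_map (free_pro_top Fin_sgrp A) (discrete_topology (carrier S)) h \<longrightarrow> h u = h v)"

definition basis_of :: "pseudoid set \<Rightarrow> nat sgrp set \<Rightarrow> bool" where
  "basis_of \<Sigma> V \<longleftrightarrow> \<Sigma> \<subseteq> pseudoids \<and> V = {S \<in> Fin_sgrp. \<forall>e\<in>\<Sigma>. satisfies S e}"

definition multiregular :: "nat sgrp set \<Rightarrow> nat set \<Rightarrow> pro_elem \<Rightarrow> bool" where
  "multiregular W A p \<longleftrightarrow> p \<in> carrier (free_pro Fin_sgrp A) \<and>
     free_cls W A p \<in> sgrp_gen (free_pro W A) {s. regular_elem (free_pro W A) s}"

definition multiregularly_based :: "nat sgrp set \<Rightarrow> nat sgrp set \<Rightarrow> bool" where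
  "multiregularly_based V W \<longleftrightarrow> (\<exists>\<Sigma>. basis_of \<Sigma> V \<and>
     (\<forall>(A, p, r)\<in>\<Sigma>. multiregular W A p \<and> multiregular W A r))"


section \<open>Languages and bideterministic product\<close>

definition plus_words :: "nat set \<Rightarrow> nat list set" where
  "plus_words A = lists A - {[]}"

definition free_sgrp :: "nat set \<Rightarrow> nat list sgrp" where
  "free_sgrp A = \<lparr>carrier = plus_words A, mul = (@)\<rparr>"

definition recognizable :: "nat sgrp set \<Rightarrow> nat set \<Rightarrow> nat list set \<Rightarrow> bool" where
  "recognizable V A L \<longleftrightarrow> L \<subseteq> plus_words A \<and>
     (\<exists>S\<in>V. \<exists>\<phi>\<in>sgrp_hom (free_sgrp A) S. L = {w \<in> plus_words A. \<phi> w \<in> \<phi> ` L})"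

definition prefix_code :: "nat set \<Rightarrow> nat list set \<Rightarrow> bool" where
  "prefix_code A L \<longleftrightarrow> L \<subseteq> lists A \<and> (\<forall>u\<in>L. {u @ v |v. v \<in> plus_words A} \<inter> L = {})"

definition suffix_code :: "nat set \<Rightarrow> nat list set \<Rightarrow> bool" where
  "suffix_code A L \<longleftrightarrow> L \<subseteq> lists A \<and> (\<forall>u\<in>L. {v @ u |v. v \<in> plus_words A} \<inter> L = {})"

definition bidet_closed :: "nat sgrp set \<Rightarrow> bool" where
  "bidet_closed V \<longleftrightarrow> (\<forall>A a L K. alphabet A \<longrightarrow> a \<in> A \<longrightarrow>
     (recognizable V A L \<or> L = {[]}) \<longrightarrow> (recognizable V A K \<or> K = {[]}) \<longrightarrow>
     prefix_code A {u @ [a] |u. u \<in> L} \<longrightarrow> suffix_code A {[a] @ v |v. v \<in> K} \<longrightarrow>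
     recognizable V A {u @ [a] @ v |u v. u \<in> L \<and> v \<in> K})"

end

theory Submission
  imports Defs
begin

text \<open>
  Let \<open>P = LaK\<close> be a bideterministic product of \<open>V\<close>-recognizable languages. As \<open>W\<close> is closed
  under bideterministic product, the syntactic semigroup \<open>M\<close> of \<open>P\<close> lies in \<open>W\<close>, and it must be
  shown to satisfy every pseudoidentity \<open>\<pi> = \<rho>\<close> of a basis of \<open>V\<close> whose sides are
  \<open>W\<close>-multiregular.

  The heart of the matter is combinatorial (\<open>marker_outside_regular_product\<close>). Call a word \<open>w\<close>
  regular relative to \<open>P\<close> if some word \<open>s\<close> is such that \<open>wsw\<close> may replace \<open>w\<close> inside every member
  of \<open>P\<close>. In a factorization \<open>xwy = lak\<close> with \<open>l \<in> L\<close> and \<open>k \<in> K\<close>, the marked letter \<open>a\<close> cannot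
  fall inside such a \<open>w\<close>: if \<open>w = paq\<close>, then \<open>xpaqspaqy \<in> P\<close>; because \<open>La\<close> is a prefix code, the
  marked letter of this word is the first displayed \<open>a\<close>, so that both \<open>aqy\<close> and \<open>aqspaqy\<close> are in
  \<open>aK\<close>, which is a suffix code. Hence the marked letter cannot fall inside a product of regular
  words either.

  A value of \<open>\<pi>\<close> in \<open>M\<close> is the value of such a product. Indeed, \<open>[\<pi>]\<close> is a product of regular
  elements of the free pro-\<open>W\<close> semigroup, and the letters generate a dense subsemigroup of it; so \<open>\<pi>\<close> can
  be evaluated by one and the same product \<open>w\<close> of regular words simultaneously in \<open>M\<close> and in the
  members of \<open>V\<close> recognizing \<open>L\<close> and \<open>K\<close> (\<open>multiregular_word\<close>). Let \<open>v\<close> be such a word for \<open>\<rho>\<close>.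
  If \<open>xwy = lak\<close> is in \<open>P\<close>, then \<open>w\<close> lies inside \<open>k\<close> or inside \<open>l\<close>; there it may be replaced by
  \<open>v\<close>, since \<open>V\<close> satisfies \<open>\<pi> = \<rho>\<close>. By symmetry \<open>w\<close> and \<open>v\<close> have the same
  contexts in \<open>P\<close>, that is, they have the same value in \<open>M\<close>.
\<close>

section \<open>Words and syntactic semigroups\<close>

lemma free_sgrp_homD:
  assumes "\<phi> \<in> sgrp_hom (free_sgrp A) S"
  shows "w \<in> plus_words A \<Longrightarrow> \<phi> w \<in> carrier S"
    and "w \<in> plus_words A \<Longrightarrow> v \<in> plus_words A \<Longrightarrow> \<phi> (w @ v) = \<phi> w \<odot>\<^bsub>S\<^esub> \<phi> v"
  using assms by (auto simp: sgrp_hom_def free_sgrp_def)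

lemma plus_words_append:
  "w \<in> plus_words A \<Longrightarrow> v \<in> lists A \<Longrightarrow> w @ v \<in> plus_words A"
  "v \<in> lists A \<Longrightarrow> w \<in> plus_words A \<Longrightarrow> v @ w \<in> plus_words A"
  by (auto simp: plus_words_def)

lemma plus_words_lists: "w \<in> plus_words A \<Longrightarrow> w \<in> lists A"
  by (simp add: plus_words_def)

lemma free_sgrp_hom_context:
  assumes h: "\<phi> \<in> sgrp_hom (free_sgrp A) S" and w: "w \<in> plus_words A" "v \<in> plus_words A"
    and eq: "\<phi> w = \<phi> v" and xy: "x \<in> lists A" "y \<in> lists A"
  shows "\<phi> (x @ w @ y) = \<phi> (x @ v @ y)"
proof -
  have 1: "\<phi> (w @ y) = \<phi> (v @ y)"
  proof (cases "y = []")
    case False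
    then have "y \<in> plus_words A" using xy by (simp add: plus_words_def)
    then show ?thesis using free_sgrp_homD(2)[OF h] w eq by simp
  qed (use eq in simp)
  show ?thesis
  proof (cases "x = []")
    case False
    then have "x \<in> plus_words A" using xy by (simp add: plus_words_def)
    then show ?thesis using free_sgrp_homD(2)[OF h] w xy 1 by (simp add: plus_words_append)
  qed (use 1 in simp)
qed

lemma recognized_context:
  assumes h: "\<phi> \<in> sgrp_hom (free_sgrp A) S" and L: "L = {w \<in> plus_words A. \<phi> w \<in> \<phi> ` L}"
    and w: "w \<in> plus_words A" "v \<in> plus_words A"
    and eq: "\<phi> w = \<phi> v" and xy: "x \<in> lists A" "y \<in> lists A"
  shows "x @ w @ y \<in> L \<longleftrightarrow> x @ v @ y \<in> L"
proof -
  have mem: "u \<in> L \<longleftrightarrow> u \<in> plus_words A \<and> \<phi> u \<in> \<phi> ` L" for u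
    using L by blast
  have "x @ w @ y \<in> plus_words A" "x @ v @ y \<in> plus_words A"
    using w xy by (simp_all add: plus_words_append)
  then show ?thesis
    using free_sgrp_hom_context[OF h w eq xy] mem[of "x @ w @ y"] mem[of "x @ v @ y"] by metis
qed

definition syn_equiv :: "nat set \<Rightarrow> nat list set \<Rightarrow> nat list \<Rightarrow> nat list \<Rightarrow> bool" where
  "syn_equiv A P w v \<longleftrightarrow> (\<forall>x\<in>lists A. \<forall>y\<in>lists A. x @ w @ y \<in> P \<longleftrightarrow> x @ v @ y \<in> P)"

lemma syn_equiv_append:
  assumes "syn_equiv A P w w'" "syn_equiv A P v v'" "w' \<in> lists A" "v \<in> lists A"
  shows "syn_equiv A P (w @ v) (w' @ v')"
  unfolding syn_equiv_def
proof (intro ballI)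
  fix x y assume xy: "x \<in> lists A" "y \<in> lists A"
  have "x @ w @ (v @ y) \<in> P \<longleftrightarrow> x @ w' @ (v @ y) \<in> P"
    using assms(1)[unfolded syn_equiv_def, rule_format, of x "v @ y"] assms(4) xy
    by (simp del: in_lists_conv_set)
  also have "\<dots> \<longleftrightarrow> (x @ w') @ v' @ y \<in> P"
    using assms(2)[unfolded syn_equiv_def, rule_format, of "x @ w'" y] assms(3) xy
    by (simp del: in_lists_conv_set)
  finally show "x @ (w @ v) @ y \<in> P \<longleftrightarrow> x @ (w' @ v') @ y \<in> P" by simp
qed

text \<open>
  The syntactic semigroup divides every recognizing semigroup \<open>R\<close>. The values in \<open>R\<close> of a chosen
  word of each syntactic class serve as its elements, which keeps the carrier a set of natural
  numbers.
\<close>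

lemma syntactic_semigroup:
  assumes W: "pseudovariety W" and A: "alphabet A" and P: "recognizable W A P"
  obtains M \<mu> where "M \<in> W" "\<mu> \<in> sgrp_hom (free_sgrp A) M" "carrier M = \<mu> ` plus_words A"
    "\<And>w v. w \<in> plus_words A \<Longrightarrow> v \<in> plus_words A \<Longrightarrow> \<mu> w = \<mu> v \<longleftrightarrow> syn_equiv A P w v"
proof -
  let ?W = "plus_words A"
  obtain R \<phi> where R: "R \<in> W" and \<phi>: "\<phi> \<in> sgrp_hom (free_sgrp A) R"
    and rec: "P = {w \<in> ?W. \<phi> w \<in> \<phi> ` P}"
    using P unfolding recognizable_def by blast
  obtain a where "a \<in> A" using A by (auto simp: alphabet_def)
  then have "[a] \<in> ?W" by (simp add: plus_words_def)
  then have ne: "?W \<noteq> {}" by blast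
  define B where "B = \<phi> ` ?W"
  have "subsemigrp B R"
    unfolding subsemigrp_def B_def using ne free_sgrp_homD[OF \<phi>]
    by (auto simp: plus_words_append plus_words_lists simp flip: free_sgrp_homD(2)[OF \<phi>])
  then have RB: "R\<lparr>carrier := B\<rparr> \<in> W" by (rule pseudovariety_sub[OF W R])
  define \<mu> where "\<mu> = (\<lambda>w. \<phi> (SOME v. v \<in> ?W \<and> syn_equiv A P v w))"
  have rep: "\<exists>v. v \<in> ?W \<and> syn_equiv A P v w \<and> \<mu> w = \<phi> v" if "w \<in> ?W" for w
  proof -
    have "\<exists>v. v \<in> ?W \<and> syn_equiv A P v w" using that by (auto simp: syn_equiv_def)
    from someI_ex[OF this] show ?thesis unfolding \<mu>_def by blast
  qed
  have \<phi>_syn: "syn_equiv A P w v" if "w \<in> ?W" "v \<in> ?W" "\<phi> w = \<phi> v" for w v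
    unfolding syn_equiv_def using recognized_context[OF \<phi> rec that] by blast
  have \<mu>_iff: "\<mu> w = \<mu> v \<longleftrightarrow> syn_equiv A P w v" if wv: "w \<in> ?W" "v \<in> ?W" for w v
  proof
    assume "\<mu> w = \<mu> v"
    then obtain w' v' where "w' \<in> ?W" "syn_equiv A P w' w" "v' \<in> ?W" "syn_equiv A P v' v" "\<phi> w' = \<phi> v'"
      using rep[OF wv(1)] rep[OF wv(2)] by metis
    then show "syn_equiv A P w v" using \<phi>_syn[of w' v'] by (auto simp: syn_equiv_def)
  next
    assume "syn_equiv A P w v"
    then have "(\<lambda>u. u \<in> ?W \<and> syn_equiv A P u w) = (\<lambda>u. u \<in> ?W \<and> syn_equiv A P u v)"
      by (auto simp: syn_equiv_def fun_eq_iff)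
    then show "\<mu> w = \<mu> v" by (simp add: \<mu>_def)
  qed
  define n where "n = inv_into ?W \<mu>"
  have n: "n m \<in> ?W" "\<mu> (n m) = m" if "m \<in> \<mu> ` ?W" for m
    using that by (auto simp: n_def inv_into_into f_inv_into_f)
  define M :: "nat sgrp" where "M = \<lparr>carrier = \<mu> ` ?W, mul = (\<lambda>x y. \<mu> (n x @ n y))\<rparr>"
  have mul: "\<mu> w \<odot>\<^bsub>M\<^esub> \<mu> v = \<mu> (w @ v)" if "w \<in> ?W" "v \<in> ?W" for w v
  proof -
    have nw: "n (\<mu> w) \<in> ?W" "n (\<mu> v) \<in> ?W" using that n by blast+
    have "syn_equiv A P (n (\<mu> w)) w" "syn_equiv A P (n (\<mu> v)) v"
      using \<mu>_iff nw that n by blast+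
    then have "syn_equiv A P (n (\<mu> w) @ n (\<mu> v)) (w @ v)"
      using nw that by (intro syn_equiv_append) (auto simp: plus_words_lists)
    then have "\<mu> (n (\<mu> w) @ n (\<mu> v)) = \<mu> (w @ v)"
      using nw that \<mu>_iff by (simp add: plus_words_append plus_words_lists)
    then show ?thesis by (simp add: M_def)
  qed
  have cl: "w @ v \<in> ?W" if "w \<in> ?W" "v \<in> ?W" for w v
    using that by (simp add: plus_words_append plus_words_lists)
  have carM: "carrier M = \<mu> ` ?W" by (simp add: M_def)
  have \<mu>: "\<mu> \<in> sgrp_hom (free_sgrp A) M"
    using mul by (auto simp: sgrp_hom_def free_sgrp_def carM)
  have Msg: "semigrp M"
    unfolding semigrp_def carM using ne mul cl by auto
  define h where "h = (\<lambda>r. \<mu> (inv_into ?W \<phi> r))"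
  have h: "h (\<phi> w) = \<mu> w" if "w \<in> ?W" for w
  proof -
    have "inv_into ?W \<phi> (\<phi> w) \<in> ?W" "\<phi> (inv_into ?W \<phi> (\<phi> w)) = \<phi> w"
      using that by (auto simp: inv_into_into f_inv_into_f)
    then show ?thesis using \<phi>_syn \<mu>_iff that unfolding h_def by blast
  qed
  have hB: "h ` B = \<mu> ` ?W"
    unfolding B_def image_image using h by (rule image_cong[OF refl])
  have "h (r \<odot>\<^bsub>R\<^esub> s) = h r \<odot>\<^bsub>M\<^esub> h s" if "r \<in> B" "s \<in> B" for r s
  proof -
    obtain w v where wv: "w \<in> ?W" "v \<in> ?W" "r = \<phi> w" "s = \<phi> v"
      using \<open>r \<in> B\<close> \<open>s \<in> B\<close> unfolding B_def by blast
    have "h (r \<odot>\<^bsub>R\<^esub> s) = h (\<phi> (w @ v))" using wv free_sgrp_homD(2)[OF \<phi>] by simp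
    also have "\<dots> = \<mu> (w @ v)" using h cl wv by simp
    finally show ?thesis using mul h wv by simp
  qed
  then have hhom: "h \<in> sgrp_hom (R\<lparr>carrier := B\<rparr>) M"
    using hB by (auto simp: sgrp_hom_def carM)
  have "finite B" using pseudovarietyD(2)[OF W RB] by simp
  then have "finite (carrier M)" using hB carM by (metis finite_imageI)
  then have "M \<in> Fin_sgrp" using Msg by (simp add: Fin_sgrp_def)
  moreover have "\<forall>S\<in>W. \<forall>T\<in>Fin_sgrp. (\<exists>h\<in>sgrp_hom S T. h ` carrier S = carrier T) \<longrightarrow> T \<in> W"
    using W unfolding pseudovariety_def by (elim conjE)
  ultimately have "M \<in> W" using RB hhom hB carM by fastforce
  then show thesis using that \<mu> carM \<mu>_iff by blast
qed


section \<open>Evaluation of pseudowords in finite semigroups\<close>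

text \<open>
  The coordinate of a pseudoword at which its value in \<open>S\<close> under the substitution \<open>f\<close> is found;
  the coordinates are indexed by generated semigroups only, hence the passage to the subsemigroup
  generated by the image of \<open>f\<close>.
\<close>

definition eval_idx :: "nat set \<Rightarrow> nat sgrp \<Rightarrow> (nat \<Rightarrow> nat) \<Rightarrow> pro_index" where
  "eval_idx B S f = (S\<lparr>carrier := sgrp_gen S (f ` B)\<rparr>, restrict f B)"

lemma eval_idx_cong: "(\<And>b. b \<in> B \<Longrightarrow> f b = g b) \<Longrightarrow> eval_idx B S f = eval_idx B S g"
  using image_cong[of B B f g] by (auto simp: eval_idx_def)

lemma
  assumes V: "pseudovariety V" and B: "alphabet B" and S: "S \<in> V" and f: "f \<in> B \<rightarrow> carrier S"
  shows eval_idx_in: "eval_idx B S f \<in> gen_idx V B"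
    and eval_hom: "(\<lambda>u. u (eval_idx B S f)) \<in> sgrp_hom (free_pro V B) S"
    and eval_continuous: "continuous_map (free_pro_top V B) (discrete_topology (carrier S))
      (\<lambda>u. u (eval_idx B S f))"
    and eval_letter: "b \<in> B \<Longrightarrow> letter V B b (eval_idx B S f) = f b"
proof -
  let ?C = "sgrp_gen S (f ` B)"
  have "subsemigrp ?C S"
    using f B pseudovarietyD(1)[OF V S] by (intro subsemigrp_sgrp_gen) (auto simp: alphabet_def)
  then have CS: "?C \<subseteq> carrier S" and "S\<lparr>carrier := ?C\<rparr> \<in> V"
    using pseudovariety_sub[OF V S] by (auto simp: subsemigrp_def)
  then show i: "eval_idx B S f \<in> gen_idx V B"
    by (auto simp: eval_idx_def gen_idx_def intro: sgrp_gen.incl)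
  show "(\<lambda>u. u (eval_idx B S f)) \<in> sgrp_hom (free_pro V B) S"
    using free_pro_proj_hom[OF i] CS by (auto simp: sgrp_hom_def eval_idx_def)
  show "continuous_map (free_pro_top V B) (discrete_topology (carrier S)) (\<lambda>u. u (eval_idx B S f))"
  proof (rule continuous_map_into_fulltopology)
    show "continuous_map (free_pro_top V B) (subtopology (discrete_topology (carrier S)) ?C)
        (\<lambda>u. u (eval_idx B S f))"
      using free_pro_top_proj[OF i] CS by (simp add: eval_idx_def Int_absorb1)
  qed
  show "letter V B b (eval_idx B S f) = f b" if "b \<in> B"
    using i that by (simp add: letter_def) (simp add: eval_idx_def)
qed

lemma satisfies_iff_eval:
  assumes S: "S \<in> Fin_sgrp" and e: "(B, u, v) \<in> pseudoids"
  shows "satisfies S (B, u, v) \<longleftrightarrow>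
    (\<forall>f\<in>B \<rightarrow> carrier S. u (eval_idx B S f) = v (eval_idx B S f))"
proof -
  have B: "alphabet B" and uv: "u \<in> carrier (free_pro Fin_sgrp B)" "v \<in> carrier (free_pro Fin_sgrp B)"
    using e by (auto simp: pseudoids_def)
  note F = pseudovariety_Fin_sgrp
  have "h u = h v"
    if ev: "\<forall>f\<in>B \<rightarrow> carrier S. u (eval_idx B S f) = v (eval_idx B S f)"
      and h: "h \<in> sgrp_hom (free_pro Fin_sgrp B) S"
        "continuous_map (free_pro_top Fin_sgrp B) (discrete_topology (carrier S)) h" for h
  proof -
    define f where "f = (\<lambda>b. h (letter Fin_sgrp B b))"
    have f: "f \<in> B \<rightarrow> carrier S"
      using h(1) letter_in_free_pro[OF F B] by (auto simp: f_def sgrp_hom_def)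
    have "h x = x (eval_idx B S f)" if "x \<in> carrier (free_pro Fin_sgrp B)" for x
      using free_pro_hom_unique[OF F B h eval_hom[OF F B S f] eval_continuous[OF F B S f] _ that]
        eval_letter[OF F B S f] by (simp add: f_def)
    then show ?thesis using ev f uv by simp
  qed
  moreover have "u (eval_idx B S f) = v (eval_idx B S f)"
    if "satisfies S (B, u, v)" "f \<in> B \<rightarrow> carrier S" for f
    using that eval_hom[OF F B S] eval_continuous[OF F B S] unfolding satisfies_def by fastforce
  ultimately show ?thesis unfolding satisfies_def by auto
qed

text \<open>
  A substitution \<open>\<omega>\<close> of words over \<open>A\<close> for the letters in \<open>B\<close> followed by homomorphisms \<open>\<phi>\<close> into
  finite semigroups: as the letters generate a dense subsemigroup, finitely many such values of
  a pseudoword come from a single word.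
\<close>

lemma pseudoword_approx:
  assumes W: "pseudovariety W" and B: "alphabet B" and \<omega>: "\<omega> \<in> B \<rightarrow> plus_words A"
    and F: "finite F" "\<And>S \<phi>. (S, \<phi>) \<in> F \<Longrightarrow> S \<in> W \<and> \<phi> \<in> sgrp_hom (free_sgrp A) S"
    and u: "u \<in> carrier (free_pro W B)"
  shows "\<exists>w\<in>plus_words A. \<forall>(S, \<phi>)\<in>F. \<phi> w = u (eval_idx B S (\<phi> \<circ> \<omega>))"
proof -
  let ?I = "(\<lambda>(S, \<phi>). eval_idx B S (\<phi> \<circ> \<omega>)) ` F"
  have f: "\<phi> \<circ> \<omega> \<in> B \<rightarrow> carrier S" if "(S, \<phi>) \<in> F" for S \<phi>
    using free_sgrp_homD(1)[of \<phi> A S] F(2)[OF that] \<omega> by (simp add: Pi_iff)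
  have I: "?I \<subseteq> gen_idx W B" using eval_idx_in[OF W B _ f] F(2) by auto
  obtain g where g: "g \<in> sgrp_gen (free_pro W B) (letter W B ` B)" "\<forall>i\<in>?I. g i = u i"
    using letters_dense[OF W B finite_imageI[OF F(1)] I u] by blast
  have lc: "letter W B ` B \<subseteq> carrier (free_pro W B)" using letter_in_free_pro[OF W B] by auto
  have "\<exists>w\<in>plus_words A. \<forall>(S, \<phi>)\<in>F. \<phi> w = g (eval_idx B S (\<phi> \<circ> \<omega>))"
    using g(1)
  proof induction
    case (incl x)
    then obtain b where b: "b \<in> B" "x = letter W B b" by blast
    have "\<phi> (\<omega> b) = x (eval_idx B S (\<phi> \<circ> \<omega>))" if "(S, \<phi>) \<in> F" for S \<phi>
      using eval_letter[OF W B _ f[OF that] b(1)] F(2)[OF that] b(2) by simp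
    moreover have "\<omega> b \<in> plus_words A" using \<omega> b(1) by auto
    ultimately show ?case by blast
  next
    case (mult x y)
    then obtain w v where w: "w \<in> plus_words A" "\<forall>(S, \<phi>)\<in>F. \<phi> w = x (eval_idx B S (\<phi> \<circ> \<omega>))"
      and v: "v \<in> plus_words A" "\<forall>(S, \<phi>)\<in>F. \<phi> v = y (eval_idx B S (\<phi> \<circ> \<omega>))" by blast
    have xy: "x \<in> carrier (free_pro W B)" "y \<in> carrier (free_pro W B)"
      using mult sgrp_gen_subset[OF semigrp_free_pro[OF W B] lc] by auto
    have "\<phi> (w @ v) = (x \<odot>\<^bsub>free_pro W B\<^esub> y) (eval_idx B S (\<phi> \<circ> \<omega>))" if "(S, \<phi>) \<in> F" for S \<phi>
    proof -
      have "\<phi> (w @ v) = \<phi> w \<odot>\<^bsub>S\<^esub> \<phi> v"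
        using F(2)[OF that] w(1) v(1) free_sgrp_homD(2)[of \<phi> A S] by blast
      then show ?thesis
        using eval_hom[OF W B _ f[OF that]] F(2)[OF that] w(2) v(2) xy that
        by (fastforce simp: sgrp_hom_def)
    qed
    moreover have "w @ v \<in> plus_words A"
      using w(1) v(1) by (simp add: plus_words_append plus_words_lists)
    ultimately show ?case by blast
  qed
  then show ?thesis using g(2) by fastforce
qed

text \<open>
  Approximating both a regular element \<open>r = rxr\<close> and its witness \<open>x\<close> gives a word that is regular
  as far as the finitely many homomorphisms in \<open>F\<close> can tell.
\<close>

lemma multiregular_word:
  assumes W: "pseudovariety W" and B: "alphabet B" and \<omega>: "\<omega> \<in> B \<rightarrow> plus_words A"
    and F: "finite F" "\<And>S \<phi>. (S, \<phi>) \<in> F \<Longrightarrow> S \<in> W \<and> \<phi> \<in> sgrp_hom (free_sgrp A) S"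
    and p: "multiregular W B p"
  shows "\<exists>w\<in>sgrp_gen (free_sgrp A)
      {w \<in> plus_words A. \<exists>s\<in>plus_words A. \<forall>(S, \<phi>)\<in>F. \<phi> (w @ s @ w) = \<phi> w}.
    \<forall>(S, \<phi>)\<in>F. \<phi> w = p (eval_idx B S (\<phi> \<circ> \<omega>))"
proof -
  let ?R = "{w \<in> plus_words A. \<exists>s\<in>plus_words A. \<forall>(S, \<phi>)\<in>F. \<phi> (w @ s @ w) = \<phi> w}"
  have f: "\<phi> \<circ> \<omega> \<in> B \<rightarrow> carrier S" if "(S, \<phi>) \<in> F" for S \<phi>
    using free_sgrp_homD(1)[of \<phi> A S] F(2)[OF that] \<omega> by (simp add: Pi_iff)
  have Fhom: "\<phi> (w @ v) = \<phi> w \<odot>\<^bsub>S\<^esub> \<phi> v"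
    if "(S, \<phi>) \<in> F" "w \<in> plus_words A" "v \<in> plus_words A" for S \<phi> w v
    using F(2)[OF that(1)] that(2,3) free_sgrp_homD(2)[of \<phi> A S] by blast
  have ev: "(x \<odot>\<^bsub>free_pro W B\<^esub> y) (eval_idx B S (\<phi> \<circ> \<omega>)) =
      x (eval_idx B S (\<phi> \<circ> \<omega>)) \<odot>\<^bsub>S\<^esub> y (eval_idx B S (\<phi> \<circ> \<omega>))"
    if "(S, \<phi>) \<in> F" "x \<in> carrier (free_pro W B)" "y \<in> carrier (free_pro W B)" for S \<phi> x y
    using eval_hom[OF W B _ f[OF that(1)]] F(2)[OF that(1)] that(2,3) by (simp add: sgrp_hom_def)
  have pc: "p \<in> carrier (free_pro Fin_sgrp B)"
    and pg: "free_cls W B p \<in> sgrp_gen (free_pro W B) {s. regular_elem (free_pro W B) s}"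
    using p by (auto simp: multiregular_def)
  have rc: "{s. regular_elem (free_pro W B) s} \<subseteq> carrier (free_pro W B)"
    by (auto simp: regular_elem_def)
  note gc = sgrp_gen_subset[OF semigrp_free_pro[OF W B] rc]
  have mul_closed: "x \<odot>\<^bsub>free_pro W B\<^esub> y \<in> carrier (free_pro W B)"
    if "x \<in> carrier (free_pro W B)" "y \<in> carrier (free_pro W B)" for x y
    using semigrp_free_pro[OF W B] that by (simp add: semigrp_def)
  have gW: "w \<in> plus_words A" if "w \<in> sgrp_gen (free_sgrp A) ?R" for w
    using that by induction (auto simp: free_sgrp_def plus_words_def)
  have "\<exists>w\<in>sgrp_gen (free_sgrp A) ?R. \<forall>(S, \<phi>)\<in>F. \<phi> w = free_cls W B p (eval_idx B S (\<phi> \<circ> \<omega>))"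
    using pg
  proof induction
    case (incl r)
    then obtain x where r: "r \<in> carrier (free_pro W B)" and x: "x \<in> carrier (free_pro W B)"
      and rxr: "r = r \<odot>\<^bsub>free_pro W B\<^esub> x \<odot>\<^bsub>free_pro W B\<^esub> r" by (auto simp: regular_elem_def)
    obtain w where w: "w \<in> plus_words A" "\<forall>(S, \<phi>)\<in>F. \<phi> w = r (eval_idx B S (\<phi> \<circ> \<omega>))"
      using pseudoword_approx[OF W B \<omega> F r] by blast
    obtain s where s: "s \<in> plus_words A" "\<forall>(S, \<phi>)\<in>F. \<phi> s = x (eval_idx B S (\<phi> \<circ> \<omega>))"
      using pseudoword_approx[OF W B \<omega> F x] by blast
    have "\<phi> (w @ s @ w) = \<phi> w" if SF: "(S, \<phi>) \<in> F" for S \<phi>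
    proof -
      let ?i = "eval_idx B S (\<phi> \<circ> \<omega>)"
      have "\<phi> ((w @ s) @ w) = \<phi> w \<odot>\<^bsub>S\<^esub> \<phi> s \<odot>\<^bsub>S\<^esub> \<phi> w"
        using Fhom[OF SF] w(1) s(1) by (simp add: plus_words_append plus_words_lists del: append_assoc)
      also have "\<dots> = r ?i \<odot>\<^bsub>S\<^esub> x ?i \<odot>\<^bsub>S\<^esub> r ?i" using w(2) s(2) SF by fastforce
      also have "\<dots> = (r \<odot>\<^bsub>free_pro W B\<^esub> x \<odot>\<^bsub>free_pro W B\<^esub> r) ?i"
        using ev[OF SF] r x mul_closed by simp
      also have "\<dots> = \<phi> w" using w(2) SF rxr by fastforce
      finally show ?thesis by simp
    qed
    then have "w \<in> ?R" using w(1) s(1) by blast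
    then show ?case using w(2) by (blast intro: sgrp_gen.incl)
  next
    case (mult x y)
    then obtain w v where w: "w \<in> sgrp_gen (free_sgrp A) ?R" "\<forall>(S, \<phi>)\<in>F. \<phi> w = x (eval_idx B S (\<phi> \<circ> \<omega>))"
      and v: "v \<in> sgrp_gen (free_sgrp A) ?R" "\<forall>(S, \<phi>)\<in>F. \<phi> v = y (eval_idx B S (\<phi> \<circ> \<omega>))" by blast
    have xy: "x \<in> carrier (free_pro W B)" "y \<in> carrier (free_pro W B)" using mult gc by auto
    have "\<phi> (w @ v) = (x \<odot>\<^bsub>free_pro W B\<^esub> y) (eval_idx B S (\<phi> \<circ> \<omega>))" if "(S, \<phi>) \<in> F" for S \<phi>
      using ev[OF that xy] Fhom[OF that gW[OF w(1)] gW[OF v(1)]] w(2) v(2) that by fastforce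
    moreover have "w @ v \<in> sgrp_gen (free_sgrp A) ?R"
      using sgrp_gen.mult[OF w(1) v(1)] by (simp add: free_sgrp_def)
    ultimately show ?case by blast
  qed
  then obtain w where w: "w \<in> sgrp_gen (free_sgrp A) ?R"
    "\<forall>(S, \<phi>)\<in>F. \<phi> w = free_cls W B p (eval_idx B S (\<phi> \<circ> \<omega>))" by blast
  have cls: "free_cls W B p (eval_idx B S (\<phi> \<circ> \<omega>)) = p (eval_idx B S (\<phi> \<circ> \<omega>))"
    if "(S, \<phi>) \<in> F" for S \<phi>
    using free_cls_eq[OF W B pc] eval_idx_in[OF W B _ f[OF that]] F(2)[OF that] by simp
  have "\<phi> w = p (eval_idx B S (\<phi> \<circ> \<omega>))" if "(S, \<phi>) \<in> F" for S \<phi>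
    using w(2) cls[OF that] that by fastforce
  then show ?thesis using w(1) by blast
qed


section \<open>The marked letter of a bideterministic product\<close>

text \<open>
  If the marked letter fell inside \<open>w\<close>, then repeating \<open>w\<close> would leave the marked letter at its
  place, by the prefix code \<open>La\<close>, and extend the tail \<open>ak\<close> to the left within the suffix code
  \<open>aK\<close>.
\<close>

lemma marker_outside_regular:
  assumes pre: "prefix_code A {u @ [a] |u. u \<in> L}" and suf: "suffix_code A {[a] @ v |v. v \<in> K}"
    and pump: "x @ w @ y \<in> {u @ [a] @ v |u v. u \<in> L \<and> v \<in> K} \<Longrightarrow>
      x @ (w @ s @ w) @ y \<in> {u @ [a] @ v |u v. u \<in> L \<and> v \<in> K}"
    and s: "s \<in> lists A"
    and l: "l \<in> L" and k: "k \<in> K" and eq: "x @ w @ y = l @ a # k"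
  shows "(\<exists>x'. x = l @ a # x') \<or> (\<exists>y'. y = y' @ a # k)"
proof (rule ccontr)
  assume not: "\<not> ?thesis"
  have La: "u @ [a] \<in> lists A" if "u \<in> L" for u using that pre unfolding prefix_code_def by blast
  have aK: "[a] @ v \<in> lists A" if "v \<in> K" for v using that suf unfolding suffix_code_def by blast
  obtain p where p: "l = x @ p" "w @ y = p @ a # k"
  proof -
    from eq consider us where "x = l @ us" "us @ w @ y = a # k" | us where "x @ us = l" "w @ y = us @ a # k"
      by (auto simp only: append_eq_append_conv2)
    then show thesis
    proof cases
      case 1
      then have "us = []" using not by (cases us) auto
      then show thesis using 1 that[of "[]"] by simp
    qed (use that in blast)
  qed
  obtain q where q: "w = p @ a # q" "k = q @ y"
  proof -
    from p(2) consider us where "w = p @ us" "us @ y = a # k" | us where "w @ us = p" "y = us @ a # k"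
      by (auto simp only: append_eq_append_conv2)
    then show thesis
    proof cases
      case 1
      then have "us \<noteq> []" using not by auto
      then obtain q where "us = a # q" "k = q @ y" using 1(2) by (cases us) auto
      then show thesis using 1 that by blast
    qed (use not in blast)
  qed
  have "x @ (w @ s @ w) @ y \<in> {u @ [a] @ v |u v. u \<in> L \<and> v \<in> K}"
    using pump eq l k by auto
  then obtain l' k' where l': "l' \<in> L" and k': "k' \<in> K" and eq': "x @ (w @ s @ w) @ y = l' @ [a] @ k'"
    by blast
  then have e: "l @ a # (q @ s @ p @ a # k) = l' @ a # k'" using p q by simp
  \<comment> \<open>The prefix code condition on \<open>La\<close>: neither of \<open>l\<close> and \<open>l'\<close> extends the other by a word starting with \<open>a\<close>.\<close>
  have no_ext: False if "u \<in> L" "u' \<in> L" "u' = u @ a # t" for u u' t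
  proof -
    have "u' @ [a] = (u @ [a]) @ (t @ [a])" using that by simp
    moreover have "t @ [a] \<in> plus_words A" using La[OF that(2)] that(3) by (simp add: plus_words_def)
    ultimately show False using pre that(1,2) unfolding prefix_code_def by blast
  qed
  have "l = l'"
  proof -
    from e consider us where "l = l' @ us" "us @ a # (q @ s @ p @ a # k) = a # k'"
      | us where "l @ us = l'" "a # (q @ s @ p @ a # k) = us @ a # k'"
      by (auto simp only: append_eq_append_conv2)
    then show ?thesis
    proof cases
      case 1
      then show ?thesis using no_ext[OF l' l, of "tl us"] by (cases us) auto
    next
      case 2
      then show ?thesis using no_ext[OF l l', of "tl us"] by (cases us) auto
    qed
  qed
  then have "[a] @ k' = (a # q @ s @ p) @ ([a] @ k)" using e by simp
  moreover have "a # q @ s @ p \<in> plus_words A"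
    using La[OF l] aK[OF k] s p(1) q(2) by (simp add: plus_words_def)
  ultimately show False using suf k k' unfolding suffix_code_def by blast
qed

lemma marker_outside_regular_product:
  assumes pre: "prefix_code A {u @ [a] |u. u \<in> L}" and suf: "suffix_code A {[a] @ v |v. v \<in> K}"
    and R: "\<And>w. w \<in> R \<Longrightarrow> \<exists>s\<in>lists A. syn_equiv A {u @ [a] @ v |u v. u \<in> L \<and> v \<in> K} w (w @ s @ w)"
    and w: "w \<in> sgrp_gen (free_sgrp A) R"
    and RA: "R \<subseteq> plus_words A" and xy: "x \<in> lists A" "y \<in> lists A"
    and l: "l \<in> L" and k: "k \<in> K" and eq: "x @ w @ y = l @ a # k"
  shows "(\<exists>x'. x = l @ a # x') \<or> (\<exists>y'. y = y' @ a # k)"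
  using w xy eq
proof (induction arbitrary: x y)
  case (incl w)
  then obtain s where s: "s \<in> lists A" "syn_equiv A {u @ [a] @ v |u v. u \<in> L \<and> v \<in> K} w (w @ s @ w)"
    using R by blast
  then show ?case
    using marker_outside_regular[OF pre suf _ s(1) l k incl(4)] incl(2,3) unfolding syn_equiv_def by blast
next
  case (mult w v)
  have "sgrp_gen (free_sgrp A) R \<subseteq> plus_words A"
  proof
    fix z assume "z \<in> sgrp_gen (free_sgrp A) R"
    then show "z \<in> plus_words A" using RA by induction (auto simp: free_sgrp_def plus_words_def)
  qed
  then have wv: "w \<in> lists A" "v \<in> lists A" using mult.hyps plus_words_lists by blast+
  have e: "x @ w @ v @ y = l @ a # k" using mult.prems by (simp add: free_sgrp_def)
  consider x' where "x = l @ a # x'" | y' where "v @ y = y' @ a # k"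
    using mult.IH(1)[of x "v @ y"] mult.prems wv e by auto
  then show ?case
  proof cases
    case 2
    \<comment> \<open>The marked letter lies to the right of \<open>w\<close>, so \<open>l\<close> is too long to end within \<open>x @ w\<close>.\<close>
    then have "l = x @ w @ y'" using e by simp
    then have "\<nexists>x'. x @ w = l @ a # x'" by (auto dest: arg_cong[of _ _ length])
    then show ?thesis using mult.IH(2)[of "x @ w" y] mult.prems wv e by auto
  qed blast
qed

text \<open>
  The case \<open>L = {1}\<close> needs no homomorphism: a nonempty word placed in a context never gives the empty word.
\<close>

lemma recognizing_homs:
  assumes "recognizable V A L \<or> L = {[]}"
  obtains F where "finite F" "\<And>S \<phi>. (S, \<phi>) \<in> F \<Longrightarrow> S \<in> V \<and> \<phi> \<in> sgrp_hom (free_sgrp A) S"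
    "\<And>w v. w \<in> plus_words A \<Longrightarrow> v \<in> plus_words A \<Longrightarrow> \<forall>(S, \<phi>)\<in>F. \<phi> w = \<phi> v \<Longrightarrow> syn_equiv A L w v"
  using assms
proof
  assume "recognizable V A L"
  then obtain S \<phi> where S: "S \<in> V" "\<phi> \<in> sgrp_hom (free_sgrp A) S" "L = {w \<in> plus_words A. \<phi> w \<in> \<phi> ` L}"
    unfolding recognizable_def by blast
  have "syn_equiv A L w v" if "w \<in> plus_words A" "v \<in> plus_words A" "\<phi> w = \<phi> v" for w v
    unfolding syn_equiv_def using recognized_context[OF S(2,3) that] by blast
  then show thesis
    using S(1,2) by (intro that[of "{(S, \<phi>)}"]) auto
next
  assume "L = {[]}"
  then show thesis by (intro that[of "{}"]) (auto simp: syn_equiv_def plus_words_def)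
qed

text \<open>The marked letter stays in place while a product of regular words next to it is replaced.\<close>

lemma replace_regular_product:
  fixes L K a
  defines "P \<equiv> {u @ [a] @ v |u v. u \<in> L \<and> v \<in> K}"
  assumes pre: "prefix_code A {u @ [a] |u. u \<in> L}" and suf: "suffix_code A {[a] @ v |v. v \<in> K}"
    and R: "\<And>w. w \<in> R \<Longrightarrow> \<exists>s\<in>lists A. syn_equiv A P w (w @ s @ w)" and RA: "R \<subseteq> plus_words A"
    and w: "w \<in> sgrp_gen (free_sgrp A) R" and L: "syn_equiv A L w v" and K: "syn_equiv A K w v"
    and xy: "x \<in> lists A" "y \<in> lists A" and mem: "x @ w @ y \<in> P"
  shows "x @ v @ y \<in> P"
proof -
  obtain l k where l: "l \<in> L" and k: "k \<in> K" and eq: "x @ w @ y = l @ a # k"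
    using mem by (auto simp: P_def)
  consider x' where "x = l @ a # x'" | y' where "y = y' @ a # k"
    using marker_outside_regular_product[OF pre suf R[unfolded P_def] w RA xy l k eq] by blast
  then show ?thesis
  proof cases
    case 1
    then have "x' @ w @ y \<in> K" "x' \<in> lists A" using eq k xy by auto
    then have "x' @ v @ y \<in> K" using K xy(2) by (simp add: syn_equiv_def)
    then show ?thesis using 1 l by (fastforce simp: P_def)
  next
    case 2
    then have "x @ w @ y' \<in> L" "y' \<in> lists A" using eq l xy by auto
    then have "x @ v @ y' \<in> L" using L xy(1) by (simp add: syn_equiv_def)
    then have "(x @ v @ y') @ [a] @ k \<in> P" using k unfolding P_def by blast
    then show ?thesis using 2 by simp
  qed
qed


section \<open>Bideterministic closure of multiregularly based pseudovarieties\<close>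

theorem proposition5p8:
  fixes V W :: "nat sgrp set"
  assumes "pseudovariety V" and "pseudovariety W" and "V \<subseteq> W"
    and "multiregularly_based V W"
    and "bidet_closed W"
  shows "bidet_closed V"
  unfolding bidet_closed_def
proof (intro allI impI)
  fix A a L K
  assume A: "alphabet A" and a: "a \<in> A"
    and L: "recognizable V A L \<or> L = {[]}" and K: "recognizable V A K \<or> K = {[]}"
    and pre: "prefix_code A {u @ [a] |u. u \<in> L}" and suf: "suffix_code A {[a] @ v |v. v \<in> K}"
  note W = \<open>pseudovariety W\<close>
  define P where "P = {u @ [a] @ v |u v. u \<in> L \<and> v \<in> K}"
  have mono: "recognizable W A L'" if "recognizable V A L'" for L'
    using that \<open>V \<subseteq> W\<close> unfolding recognizable_def by blast
  have PW: "recognizable W A P"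
    using \<open>bidet_closed W\<close> A a L K mono pre suf unfolding bidet_closed_def P_def by blast
  obtain \<Sigma> where \<Sigma>: "basis_of \<Sigma> V" and mr: "\<And>B p r. (B, p, r) \<in> \<Sigma> \<Longrightarrow> multiregular W B p \<and> multiregular W B r"
    using \<open>multiregularly_based V W\<close> unfolding multiregularly_based_def by blast
  have V_iff: "S \<in> V \<longleftrightarrow> S \<in> Fin_sgrp \<and> (\<forall>e\<in>\<Sigma>. satisfies S e)" for S
    using \<Sigma> by (auto simp: basis_of_def)
  obtain M \<mu> where M: "M \<in> W" and \<mu>: "\<mu> \<in> sgrp_hom (free_sgrp A) M"
    and carM: "carrier M = \<mu> ` plus_words A"
    and \<mu>_iff: "\<And>w v. w \<in> plus_words A \<Longrightarrow> v \<in> plus_words A \<Longrightarrow> \<mu> w = \<mu> v \<longleftrightarrow> syn_equiv A P w v"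
    using syntactic_semigroup[OF W A PW] by blast
  obtain FL where FL: "finite FL" "\<And>S \<phi>. (S, \<phi>) \<in> FL \<Longrightarrow> S \<in> V \<and> \<phi> \<in> sgrp_hom (free_sgrp A) S"
    "\<And>w v. w \<in> plus_words A \<Longrightarrow> v \<in> plus_words A \<Longrightarrow> \<forall>(S, \<phi>)\<in>FL. \<phi> w = \<phi> v \<Longrightarrow> syn_equiv A L w v"
    using recognizing_homs[OF L] by blast
  obtain FK where FK: "finite FK" "\<And>S \<phi>. (S, \<phi>) \<in> FK \<Longrightarrow> S \<in> V \<and> \<phi> \<in> sgrp_hom (free_sgrp A) S"
    "\<And>w v. w \<in> plus_words A \<Longrightarrow> v \<in> plus_words A \<Longrightarrow> \<forall>(S, \<phi>)\<in>FK. \<phi> w = \<phi> v \<Longrightarrow> syn_equiv A K w v"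
    using recognizing_homs[OF K] by blast
  define F where "F = insert (M, \<mu>) (FL \<union> FK)"
  have F: "finite F" "\<And>S \<phi>. (S, \<phi>) \<in> F \<Longrightarrow> S \<in> W \<and> \<phi> \<in> sgrp_hom (free_sgrp A) S"
    using FL(1,2) FK(1,2) M \<mu> \<open>V \<subseteq> W\<close> by (auto simp: F_def)
  define R where "R = {w \<in> plus_words A. \<exists>s\<in>plus_words A. \<forall>(S, \<phi>)\<in>F. \<phi> (w @ s @ w) = \<phi> w}"
  have RA: "R \<subseteq> plus_words A" by (auto simp: R_def)
  have reg: "\<exists>s\<in>lists A. syn_equiv A P w (w @ s @ w)" if wR: "w \<in> R" for w
  proof -
    obtain s where s: "s \<in> plus_words A" "\<mu> w = \<mu> (w @ s @ w)" and w: "w \<in> plus_words A"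
      using wR unfolding R_def F_def by force
    have "w @ s @ w \<in> plus_words A" using s w by (simp add: plus_words_append plus_words_lists)
    then show ?thesis using \<mu>_iff[of w "w @ s @ w"] s w plus_words_lists by blast
  qed
  have "satisfies M (B, p, r)" if e: "(B, p, r) \<in> \<Sigma>" for B p r
  proof -
    have ps: "(B, p, r) \<in> pseudoids" using \<Sigma> e by (auto simp: basis_of_def)
    then have B: "alphabet B" by (simp add: pseudoids_def)
    have "p (eval_idx B M f) = r (eval_idx B M f)" if f: "f \<in> B \<rightarrow> carrier M" for f
    proof -
      define \<omega> where "\<omega> = (\<lambda>b. inv_into (plus_words A) \<mu> (f b))"
      have \<omega>: "\<omega> \<in> B \<rightarrow> plus_words A" using f carM inv_into_into[of _ \<mu> "plus_words A"] by (simp add: \<omega>_def Pi_iff)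
      have \<mu>\<omega>: "eval_idx B M (\<mu> \<circ> \<omega>) = eval_idx B M f"
      proof (rule eval_idx_cong)
        fix b assume "b \<in> B"
        then have "f b \<in> \<mu> ` plus_words A" using f carM by auto
        then show "(\<mu> \<circ> \<omega>) b = f b" by (simp add: \<omega>_def f_inv_into_f)
      qed
      obtain w where w: "w \<in> sgrp_gen (free_sgrp A) R" "\<And>S \<phi>. (S, \<phi>) \<in> F \<Longrightarrow> \<phi> w = p (eval_idx B S (\<phi> \<circ> \<omega>))"
        using multiregular_word[OF W B \<omega> F mr[OF e, THEN conjunct1]] unfolding R_def by blast
      obtain v where v: "v \<in> sgrp_gen (free_sgrp A) R" "\<And>S \<phi>. (S, \<phi>) \<in> F \<Longrightarrow> \<phi> v = r (eval_idx B S (\<phi> \<circ> \<omega>))"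
        using multiregular_word[OF W B \<omega> F mr[OF e, THEN conjunct2]] unfolding R_def by blast
      have "z \<in> plus_words A" if "z \<in> sgrp_gen (free_sgrp A) R" for z
        using that RA by induction (auto simp: free_sgrp_def plus_words_def)
      then have wv: "w \<in> plus_words A" "v \<in> plus_words A" using w(1) v(1) by auto
      have agree: "\<phi> w = \<phi> v" if "(S, \<phi>) \<in> FL \<union> FK" for S \<phi>
      proof -
        have S: "S \<in> V" "\<phi> \<in> sgrp_hom (free_sgrp A) S" using that FL(2) FK(2) by auto
        have "\<phi> \<circ> \<omega> \<in> B \<rightarrow> carrier S" using free_sgrp_homD(1)[OF S(2)] \<omega> by (simp add: Pi_iff)
        moreover have "S \<in> Fin_sgrp" "satisfies S (B, p, r)" using V_iff S(1) e by auto
        ultimately have "p (eval_idx B S (\<phi> \<circ> \<omega>)) = r (eval_idx B S (\<phi> \<circ> \<omega>))"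
          using satisfies_iff_eval[OF _ ps] by blast
        then show ?thesis using w(2) v(2) that by (simp add: F_def)
      qed
      have "\<forall>(S, \<phi>)\<in>FL. \<phi> w = \<phi> v" "\<forall>(S, \<phi>)\<in>FK. \<phi> w = \<phi> v" using agree by auto
      then have LK: "syn_equiv A L w v" "syn_equiv A K w v" using FL(3)[OF wv] FK(3)[OF wv] by simp_all
      then have LK': "syn_equiv A L v w" "syn_equiv A K v w" by (auto simp: syn_equiv_def)
      have "syn_equiv A P w v"
        unfolding syn_equiv_def
        using replace_regular_product[OF pre suf reg[unfolded P_def] RA w(1) LK, folded P_def]
          replace_regular_product[OF pre suf reg[unfolded P_def] RA v(1) LK', folded P_def] by blast
      then have "\<mu> w = \<mu> v" using \<mu>_iff wv by blast
      then show ?thesis using w(2)[of M \<mu>] v(2)[of M \<mu>] \<mu>\<omega> by (simp add: F_def)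
    qed
    moreover have "M \<in> Fin_sgrp" using pseudovarietyD[OF W M] by (simp add: Fin_sgrp_def)
    ultimately show ?thesis using satisfies_iff_eval[OF _ ps] by blast
  qed
  then have "M \<in> V"
    using V_iff pseudovarietyD[OF W M] by (auto simp: Fin_sgrp_def)
  moreover have "P \<subseteq> plus_words A" using PW by (simp add: recognizable_def)
  moreover have "P = {w \<in> plus_words A. \<mu> w \<in> \<mu> ` P}"
  proof -
    have "w \<in> P" if "w \<in> plus_words A" "u \<in> P" "\<mu> w = \<mu> u" for w u
    proof -
      have "syn_equiv A P w u" using that \<mu>_iff \<open>P \<subseteq> plus_words A\<close> by blast
      then have "[] @ w @ [] \<in> P \<longleftrightarrow> [] @ u @ [] \<in> P" unfolding syn_equiv_def by blast
      then show ?thesis using that(2) by simp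
    qed
    then show ?thesis using \<open>P \<subseteq> plus_words A\<close> by blast
  qed
  ultimately show "recognizable V A {u @ [a] @ v |u v. u \<in> L \<and> v \<in> K}"
    using \<mu> unfolding recognizable_def P_def[symmetric] by blast
qed

end
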